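(* Let $\mathcal{C}$ be a preregular, finitary extensive category in which every effective epimorphism has a kernel pair (i.e. for every effective epimorphism $\pi\colon X\to B$ the pullback $X\times_B X$ exists). A presheaf $F\colon\mathcal{C}^{\mathrm{op}}\to\mathsf{Set}$ is a sheaf for the coherent topology on $\mathcal{C}$ if and only if both of the following hold: (1) for every effective epimorphism $\pi\colon X\to B$ in $\mathcal{C}$, the diagram $F(B)\xrightarrow{F(\pi)}F(X)\rightrightarrows F(X\times_B X)$ is an equalizer, the two parallel maps being induced by the two projections $X\times_B X\to X$; (2) $F$ preserves finite products.
   Context: A morphism $f\colon Y\to X$ is an effective epimorphism if for every $e\colon Y\to W$ such that $e\circ g_1=e\circ g_2$ for all $g_1,g_2\colon Z\to Y$ with $f\circ g_1=f\circ g_2$, there is a unique $d\colon X\to W$ with $d\circ f=e$. A family of morphisms $(f_i\colon X_i\to B)_{i\in I}$ is effective epimorphic if for every object $W$ and every family $(e_i\colon X_i\to W)_{i\in I}$ such that $e_i\circ g_i=e_j\circ g_j$ whenever $i,j\in I$, $g_i\colon Z\to X_i$, $g_j\colon Z\to X_j$ satisfy $f_i\circ g_i=f_j\circ g_j$, there is a unique $d\colon B\to W$ with $d\circ f_i=e_i$ for all $i$. A category is preregular if for every effective epimorphism $g\colon Z\to Y$ and every morphism $f\colon X\to Y$ there exist an effective epimorphism $h\colon W\to X$ and a morphism $i\colon W\to Z$ with $g\circ i=f\circ h$. A category is finitary extensive if it has finite coproducts, it has pullbacks along coprojections of finite coproducts, and for every commutative diagram with top row $Z_1\to Z\leftarrow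 Z_2$, bottom row the coprojections $X\to X\coprod Y\leftarrow Y$, and vertical maps $Z_1\to X$, $Z\to X\coprod Y$, $Z_2\to Y$, both squares are pullbacks if and only if the top row is a coproduct diagram. The coherent topology on $\mathcal{C}$ is the smallest Grothendieck topology in which the sieve generated by each finite effective epimorphic family is a covering sieve. (A preregular finitary extensive category is precoherent: the pullback of a finite effective epimorphic family along any morphism is refined by a finite effective epimorphic family, so the finite effective epimorphic families form a coverage.) A presheaf $F$ preserves finite products if for every finite family $(T_i)_i$ of objects of $\mathcal{C}$ the natural map $F\bigl(\coprod_i T_i\bigr)\to\prod_i F(T_i)$ is a bijection. *)

theory Defs
  imports Main "HOL-Library.FuncSet"
begin

section \<open>Categories\<close>

record ('o, 'a) cat =
  Obj :: "'o set"
  Arr :: "'a set"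
  Dom :: "'a \<Rightarrow> 'o"
  Cod :: "'a \<Rightarrow> 'o"
  Id :: "'o \<Rightarrow> 'a"
  Comp :: "'a \<Rightarrow> 'a \<Rightarrow> 'a"  (infixl "\<cdot>\<index>" 70)

definition Hom :: "('o, 'a) cat \<Rightarrow> 'o \<Rightarrow> 'o \<Rightarrow> 'a set" where
  "Hom C X Y = {f \<in> Arr C. Dom C f = X \<and> Cod C f = Y}"

locale category =
  fixes C :: "('o, 'a) cat"
  assumes Dom_Obj: "f \<in> Arr C \<Longrightarrow> Dom C f \<in> Obj C"
    and Cod_Obj: "f \<in> Arr C \<Longrightarrow> Cod C f \<in> Obj C"
    and Id_Hom: "X \<in> Obj C \<Longrightarrow> Id C X \<in> Hom C X X"
    and Comp_Hom: "f \<in> Hom C X Y \<Longrightarrow> g \<in> Hom C Y Z \<Longrightarrow> g \<cdot>\<^bsub>C\<^esub> f \<in> Hom C X Z"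
    and Comp_Id: "f \<in> Hom C X Y \<Longrightarrow> f \<cdot>\<^bsub>C\<^esub> Id C X = f"
    and Id_Comp: "f \<in> Hom C X Y \<Longrightarrow> Id C Y \<cdot>\<^bsub>C\<^esub> f = f"
    and Comp_assoc: "f \<in> Hom C W X \<Longrightarrow> g \<in> Hom C X Y \<Longrightarrow> h \<in> Hom C Y Z \<Longrightarrow>
      (h \<cdot>\<^bsub>C\<^esub> g) \<cdot>\<^bsub>C\<^esub> f = h \<cdot>\<^bsub>C\<^esub> (g \<cdot>\<^bsub>C\<^esub> f)"

text \<open>The square with sides \<open>p\<close>, \<open>q\<close> out of the corner and \<open>f\<close>, \<open>g\<close> into the base,
  where \<open>f\<close> follows \<open>p\<close> and \<open>g\<close> follows \<open>q\<close>, is a pullback.\<close>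

definition is_pullback :: "('o, 'a) cat \<Rightarrow> 'a \<Rightarrow> 'a \<Rightarrow> 'a \<Rightarrow> 'a \<Rightarrow> bool" where
  "is_pullback C p q f g \<longleftrightarrow>
    (\<exists>P X Y B. p \<in> Hom C P X \<and> q \<in> Hom C P Y \<and> f \<in> Hom C X B \<and> g \<in> Hom C Y B \<and>
      f \<cdot>\<^bsub>C\<^esub> p = g \<cdot>\<^bsub>C\<^esub> q \<and>
      (\<forall>Z\<in>Obj C. \<forall>u\<in>Hom C Z X. \<forall>v\<in>Hom C Z Y. f \<cdot>\<^bsub>C\<^esub> u = g \<cdot>\<^bsub>C\<^esub> v \<longrightarrow>
        (\<exists>!w. w \<in> Hom C Z P \<and> p \<cdot>\<^bsub>C\<^esub> w = u \<and> q \<cdot>\<^bsub>C\<^esub> w = v)))"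

definition is_coproduct ::
  "('o, 'a) cat \<Rightarrow> 'i set \<Rightarrow> ('i \<Rightarrow> 'o) \<Rightarrow> 'o \<Rightarrow> ('i \<Rightarrow> 'a) \<Rightarrow> bool" where
  "is_coproduct C I T Q \<iota> \<longleftrightarrow>
    Q \<in> Obj C \<and> (\<forall>i\<in>I. \<iota> i \<in> Hom C (T i) Q) \<and>
    (\<forall>W\<in>Obj C. \<forall>e. (\<forall>i\<in>I. e i \<in> Hom C (T i) W) \<longrightarrow>
      (\<exists>!d. d \<in> Hom C Q W \<and> (\<forall>i\<in>I. d \<cdot>\<^bsub>C\<^esub> \<iota> i = e i)))"

definition is_binary_coproduct :: "('o, 'a) cat \<Rightarrow> 'o \<Rightarrow> 'o \<Rightarrow> 'o \<Rightarrow> 'a \<Rightarrow> 'a \<Rightarrow> bool" where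
  "is_binary_coproduct C X Y Q i j \<longleftrightarrow>
    is_coproduct C (UNIV :: bool set) (case_bool X Y) Q (case_bool i j)"


section \<open>Effective epimorphisms, preregular and finitary extensive categories\<close>

definition effective_epi :: "('o, 'a) cat \<Rightarrow> 'o \<Rightarrow> 'o \<Rightarrow> 'a \<Rightarrow> bool" where
  "effective_epi C Y X f \<longleftrightarrow>
    f \<in> Hom C Y X \<and>
    (\<forall>W\<in>Obj C. \<forall>e\<in>Hom C Y W.
      (\<forall>Z\<in>Obj C. \<forall>g1\<in>Hom C Z Y. \<forall>g2\<in>Hom C Z Y.
        f \<cdot>\<^bsub>C\<^esub> g1 = f \<cdot>\<^bsub>C\<^esub> g2 \<longrightarrow> e \<cdot>\<^bsub>C\<^esub> g1 = e \<cdot>\<^bsub>C\<^esub> g2) \<longrightarrow>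
      (\<exists>!d. d \<in> Hom C X W \<and> d \<cdot>\<^bsub>C\<^esub> f = e))"

definition effective_epi_family ::
  "('o, 'a) cat \<Rightarrow> 'i set \<Rightarrow> ('i \<Rightarrow> 'o) \<Rightarrow> 'o \<Rightarrow> ('i \<Rightarrow> 'a) \<Rightarrow> bool" where
  "effective_epi_family C I X B f \<longleftrightarrow>
    B \<in> Obj C \<and> (\<forall>i\<in>I. f i \<in> Hom C (X i) B) \<and>
    (\<forall>W\<in>Obj C. \<forall>e. (\<forall>i\<in>I. e i \<in> Hom C (X i) W) \<longrightarrow>
      (\<forall>i\<in>I. \<forall>j\<in>I. \<forall>Z\<in>Obj C. \<forall>gi\<in>Hom C Z (X i). \<forall>gj\<in>Hom C Z (X j).
        f i \<cdot>\<^bsub>C\<^esub> gi = f j \<cdot>\<^bsub>C\<^esub> gj \<longrightarrow> e i \<cdot>\<^bsub>C\<^esub> gi = e j \<cdot>\<^bsub>C\<^esub> gj) \<longrightarrow>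
      (\<exists>!d. d \<in> Hom C B W \<and> (\<forall>i\<in>I. d \<cdot>\<^bsub>C\<^esub> f i = e i)))"

definition preregular :: "('o, 'a) cat \<Rightarrow> bool" where
  "preregular C \<longleftrightarrow>
    (\<forall>X Y Z g f. effective_epi C Z Y g \<and> f \<in> Hom C X Y \<longrightarrow>
      (\<exists>W h i. effective_epi C W X h \<and> i \<in> Hom C W Z \<and> g \<cdot>\<^bsub>C\<^esub> i = f \<cdot>\<^bsub>C\<^esub> h))"

text \<open>Finite families are indexed by finite sets of natural numbers throughout; up to
  reindexing these are all finite families, the empty one included.\<close>

definition has_finite_coproducts :: "('o, 'a) cat \<Rightarrow> bool" where
  "has_finite_coproducts C \<longleftrightarrow>
    (\<forall>(I :: nat set) T. finite I \<and> (\<forall>i\<in>I. T i \<in> Obj C) \<longrightarrow> (\<exists>Q \<iota>. is_coproduct C I T Q \<iota>))"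

definition has_pullbacks_along_coprojections :: "('o, 'a) cat \<Rightarrow> bool" where
  "has_pullbacks_along_coprojections C \<longleftrightarrow>
    (\<forall>(I :: nat set) T Q \<iota>. finite I \<and> is_coproduct C I T Q \<iota> \<longrightarrow>
      (\<forall>i\<in>I. \<forall>Z\<in>Obj C. \<forall>f\<in>Hom C Z Q. \<exists>p q. is_pullback C p q (\<iota> i) f))"

definition finitary_extensive :: "('o, 'a) cat \<Rightarrow> bool" where
  "finitary_extensive C \<longleftrightarrow>
    has_finite_coproducts C \<and> has_pullbacks_along_coprojections C \<and>
    (\<forall>X Y Q i j Z1 Z Z2 z1 z2 a c b.
      is_binary_coproduct C X Y Q i j \<and>
      z1 \<in> Hom C Z1 Z \<and> z2 \<in> Hom C Z2 Z \<and>
      a \<in> Hom C Z1 X \<and> c \<in> Hom C Z Q \<and> b \<in> Hom C Z2 Y \<and>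
      i \<cdot>\<^bsub>C\<^esub> a = c \<cdot>\<^bsub>C\<^esub> z1 \<and> j \<cdot>\<^bsub>C\<^esub> b = c \<cdot>\<^bsub>C\<^esub> z2 \<longrightarrow>
      (is_pullback C a z1 i c \<and> is_pullback C b z2 j c \<longleftrightarrow> is_binary_coproduct C Z1 Z2 Z z1 z2))"


section \<open>Grothendieck topologies and the coherent topology\<close>

definition is_sieve :: "('o, 'a) cat \<Rightarrow> 'o \<Rightarrow> 'a set \<Rightarrow> bool" where
  "is_sieve C B S \<longleftrightarrow>
    (\<forall>f\<in>S. f \<in> Arr C \<and> Cod C f = B) \<and>
    (\<forall>f\<in>S. \<forall>g\<in>Arr C. Cod C g = Dom C f \<longrightarrow> f \<cdot>\<^bsub>C\<^esub> g \<in> S)"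

definition max_sieve :: "('o, 'a) cat \<Rightarrow> 'o \<Rightarrow> 'a set" where
  "max_sieve C B = {f \<in> Arr C. Cod C f = B}"

definition pullback_sieve :: "('o, 'a) cat \<Rightarrow> 'a \<Rightarrow> 'a set \<Rightarrow> 'a set" where
  "pullback_sieve C h S = {g \<in> Arr C. Cod C g = Dom C h \<and> h \<cdot>\<^bsub>C\<^esub> g \<in> S}"

definition generated_sieve :: "('o, 'a) cat \<Rightarrow> 'i set \<Rightarrow> ('i \<Rightarrow> 'a) \<Rightarrow> 'a set" where
  "generated_sieve C I f = {f i \<cdot>\<^bsub>C\<^esub> g | i g. i \<in> I \<and> g \<in> Arr C \<and> Cod C g = Dom C (f i)}"

definition grothendieck_topology :: "('o, 'a) cat \<Rightarrow> ('o \<Rightarrow> 'a set set) \<Rightarrow> bool" where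
  "grothendieck_topology C J \<longleftrightarrow>
    (\<forall>B\<in>Obj C. \<forall>S\<in>J B. is_sieve C B S) \<and>
    (\<forall>B\<in>Obj C. max_sieve C B \<in> J B) \<and>
    (\<forall>A\<in>Obj C. \<forall>B\<in>Obj C. \<forall>S\<in>J B. \<forall>h\<in>Hom C A B. pullback_sieve C h S \<in> J A) \<and>
    (\<forall>B\<in>Obj C. \<forall>S\<in>J B. \<forall>R. is_sieve C B R \<and> (\<forall>f\<in>S. pullback_sieve C f R \<in> J (Dom C f)) \<longrightarrow>
      R \<in> J B)"

lemma grothendieck_topology_stable:
  "grothendieck_topology C J \<Longrightarrow> A \<in> Obj C \<Longrightarrow> B \<in> Obj C \<Longrightarrow> S \<in> J B \<Longrightarrow> h \<in> Hom C A B \<Longrightarrow>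
    pullback_sieve C h S \<in> J A"
  by (simp add: grothendieck_topology_def)

lemma grothendieck_topology_transitive:
  "grothendieck_topology C J \<Longrightarrow> B \<in> Obj C \<Longrightarrow> S \<in> J B \<Longrightarrow> is_sieve C B R \<Longrightarrow>
    (\<And>f. f \<in> S \<Longrightarrow> pullback_sieve C f R \<in> J (Dom C f)) \<Longrightarrow> R \<in> J B"
  unfolding grothendieck_topology_def by meson

definition covers_finite_effective_epi_families ::
  "('o, 'a) cat \<Rightarrow> ('o \<Rightarrow> 'a set set) \<Rightarrow> bool" where
  "covers_finite_effective_epi_families C J \<longleftrightarrow>
    (\<forall>(I :: nat set) X B f. finite I \<and> effective_epi_family C I X B f \<longrightarrow>
      generated_sieve C I f \<in> J B)"

text \<open>The intersection of all topologies in which finite effective epimorphic families cover;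
  the lemmas at the end of this section show that it is the smallest one.\<close>

definition coherent_topology :: "('o, 'a) cat \<Rightarrow> 'o \<Rightarrow> 'a set set" where
  "coherent_topology C B =
    \<Inter> {J B | J. grothendieck_topology C J \<and> covers_finite_effective_epi_families C J}"

lemma coherent_topology_least:
  assumes "grothendieck_topology C J" "covers_finite_effective_epi_families C J"
  shows "coherent_topology C B \<subseteq> J B"
  using assms unfolding coherent_topology_def by blast

lemma coherent_topology_covers:
  "covers_finite_effective_epi_families C (coherent_topology C)"
  unfolding coherent_topology_def covers_finite_effective_epi_families_def by blast

context category begin

lemma is_sieve_generated:
  assumes "effective_epi_family C I X B f"
  shows "is_sieve C B (generated_sieve C I f)"
proof -
  have f: "f i \<in> Hom C (X i) B" if "i \<in> I" for i
    using assms that unfolding effective_epi_family_def by blast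
  have 1: "h \<in> Arr C \<and> Cod C h = B" if h0: "h \<in> generated_sieve C I f" for h
  proof -
    obtain i g where i: "i \<in> I" and g: "g \<in> Arr C" "Cod C g = Dom C (f i)" and
      h: "h = f i \<cdot>\<^bsub>C\<^esub> g"
      using h0 unfolding generated_sieve_def by blast
    have "g \<in> Hom C (Dom C g) (X i)" using f[OF i] g by (auto simp: Hom_def)
    from Comp_Hom[OF this f[OF i]] show ?thesis by (auto simp: Hom_def h)
  qed
  have 2: "h \<cdot>\<^bsub>C\<^esub> k \<in> generated_sieve C I f"
    if h0: "h \<in> generated_sieve C I f" and k0: "k \<in> Arr C" "Cod C k = Dom C h" for h k
  proof -
    obtain i g where i: "i \<in> I" and g: "g \<in> Arr C" "Cod C g = Dom C (f i)" and
      h: "h = f i \<cdot>\<^bsub>C\<^esub> g"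
      using h0 unfolding generated_sieve_def by blast
    have gH: "g \<in> Hom C (Dom C g) (X i)" using f[OF i] g by (auto simp: Hom_def)
    have "Dom C h = Dom C g"
      using Comp_Hom[OF gH f[OF i]] by (auto simp: Hom_def h)
    then have kH: "k \<in> Hom C (Dom C k) (Dom C g)" using k0 by (auto simp: Hom_def)
    have "h \<cdot>\<^bsub>C\<^esub> k = f i \<cdot>\<^bsub>C\<^esub> (g \<cdot>\<^bsub>C\<^esub> k)"
      unfolding h by (rule Comp_assoc[OF kH gH f[OF i]])
    moreover have "g \<cdot>\<^bsub>C\<^esub> k \<in> Arr C" "Cod C (g \<cdot>\<^bsub>C\<^esub> k) = Dom C (f i)"
      using Comp_Hom[OF kH gH] f[OF i] by (auto simp: Hom_def)
    ultimately show ?thesis using i unfolding generated_sieve_def by blast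
  qed
  show ?thesis unfolding is_sieve_def using 1 2 by blast
qed

lemma is_sieve_pullback:
  assumes "is_sieve C B S" "h \<in> Hom C A B"
  shows "is_sieve C A (pullback_sieve C h S)"
proof -
  have "g \<cdot>\<^bsub>C\<^esub> k \<in> pullback_sieve C h S"
    if g: "g \<in> pullback_sieve C h S" and k: "k \<in> Arr C" "Cod C k = Dom C g" for g k
  proof -
    have gH: "g \<in> Hom C (Dom C g) A" and hg: "h \<cdot>\<^bsub>C\<^esub> g \<in> S"
      using g assms(2) by (auto simp: pullback_sieve_def Hom_def)
    have kH: "k \<in> Hom C (Dom C k) (Dom C g)" using k by (auto simp: Hom_def)
    have "Dom C (h \<cdot>\<^bsub>C\<^esub> g) = Dom C g"
      using Comp_Hom[OF gH assms(2)] by (auto simp: Hom_def)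
    then have "(h \<cdot>\<^bsub>C\<^esub> g) \<cdot>\<^bsub>C\<^esub> k \<in> S"
      using assms(1) hg k unfolding is_sieve_def by simp
    then have "h \<cdot>\<^bsub>C\<^esub> (g \<cdot>\<^bsub>C\<^esub> k) \<in> S"
      using Comp_assoc[OF kH gH assms(2)] by simp
    then show ?thesis
      using Comp_Hom[OF kH gH] assms(2) by (auto simp: pullback_sieve_def Hom_def)
  qed
  then show ?thesis
    using assms(2) unfolding is_sieve_def by (auto simp: pullback_sieve_def Hom_def)
qed

lemma is_sieve_max: "is_sieve C B (max_sieve C B)"
proof -
  have "f \<cdot>\<^bsub>C\<^esub> g \<in> max_sieve C B"
    if "f \<in> max_sieve C B" "g \<in> Arr C" "Cod C g = Dom C f" for f g
    using that Comp_Hom[of g "Dom C g" "Dom C f" f B] by (auto simp: max_sieve_def Hom_def)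
  then show ?thesis unfolding is_sieve_def by (auto simp: max_sieve_def)
qed

lemma grothendieck_topology_coherent: "grothendieck_topology C (coherent_topology C)"
proof -
  let ?D = "\<lambda>B. {S. is_sieve C B S}"
  have D: "grothendieck_topology C ?D"
    unfolding grothendieck_topology_def using is_sieve_pullback is_sieve_max by blast
  have "covers_finite_effective_epi_families C ?D"
    unfolding covers_finite_effective_epi_families_def using is_sieve_generated by blast
  from coherent_topology_least[OF D this]
  have sieve: "is_sieve C B S" if "S \<in> coherent_topology C B" for B S using that by blast
  have mem: "S \<in> coherent_topology C B \<longleftrightarrow>
      (\<forall>J. grothendieck_topology C J \<and> covers_finite_effective_epi_families C J \<longrightarrow> S \<in> J B)"
    for S B unfolding coherent_topology_def by blast
  show ?thesis
    unfolding grothendieck_topology_def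
  proof (intro conjI ballI allI impI)
    fix B S assume "S \<in> coherent_topology C B"
    then show "is_sieve C B S" by (rule sieve)
  next
    fix B assume "B \<in> Obj C"
    then show "max_sieve C B \<in> coherent_topology C B"
      unfolding mem grothendieck_topology_def by blast
  next
    fix A B S h assume "A \<in> Obj C" "B \<in> Obj C" "S \<in> coherent_topology C B" "h \<in> Hom C A B"
    then show "pullback_sieve C h S \<in> coherent_topology C A"
      unfolding mem using grothendieck_topology_stable by metis
  next
    fix B S R assume B: "B \<in> Obj C" and S: "S \<in> coherent_topology C B" and
      R: "is_sieve C B R \<and> (\<forall>f\<in>S. pullback_sieve C f R \<in> coherent_topology C (Dom C f))"
    show "R \<in> coherent_topology C B"
      unfolding mem
    proof (intro allI impI)
      fix J assume J: "grothendieck_topology C J \<and> covers_finite_effective_epi_families C J"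
      have "S \<in> J B" "\<forall>f\<in>S. pullback_sieve C f R \<in> J (Dom C f)"
        using S R J unfolding mem by simp_all
      then show "R \<in> J B"
        using grothendieck_topology_transitive[of C J B S R] J B R by simp
    qed
  qed
qed

end


section \<open>Presheaves of sets\<close>

text \<open>The sets \<open>F(X)\<close> are subsets of one common type, and \<open>F(f)\<close> is a function on that
  type of which only the restriction to \<open>F(Cod f)\<close> matters.\<close>

record ('o, 'a, 'v) psh =
  PObj :: "'o \<Rightarrow> 'v set"
  PMap :: "'a \<Rightarrow> 'v \<Rightarrow> 'v"

definition presheaf :: "('o, 'a) cat \<Rightarrow> ('o, 'a, 'v) psh \<Rightarrow> bool" where
  "presheaf C F \<longleftrightarrow>
    (\<forall>X\<in>Obj C. \<forall>Y\<in>Obj C. \<forall>f\<in>Hom C X Y. PMap F f \<in> PObj F Y \<rightarrow> PObj F X) \<and>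
    (\<forall>X\<in>Obj C. \<forall>x\<in>PObj F X. PMap F (Id C X) x = x) \<and>
    (\<forall>X\<in>Obj C. \<forall>Y\<in>Obj C. \<forall>Z\<in>Obj C. \<forall>f\<in>Hom C X Y. \<forall>g\<in>Hom C Y Z. \<forall>x\<in>PObj F Z.
      PMap F (g \<cdot>\<^bsub>C\<^esub> f) x = PMap F f (PMap F g x))"

definition matching_family ::
  "('o, 'a) cat \<Rightarrow> ('o, 'a, 'v) psh \<Rightarrow> 'a set \<Rightarrow> ('a \<Rightarrow> 'v) \<Rightarrow> bool" where
  "matching_family C F S x \<longleftrightarrow>
    (\<forall>f\<in>S. x f \<in> PObj F (Dom C f)) \<and>
    (\<forall>f\<in>S. \<forall>g\<in>Arr C. Cod C g = Dom C f \<longrightarrow> PMap F g (x f) = x (f \<cdot>\<^bsub>C\<^esub> g))"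

definition is_sheaf ::
  "('o, 'a) cat \<Rightarrow> ('o \<Rightarrow> 'a set set) \<Rightarrow> ('o, 'a, 'v) psh \<Rightarrow> bool" where
  "is_sheaf C J F \<longleftrightarrow>
    (\<forall>B\<in>Obj C. \<forall>S\<in>J B. \<forall>x. matching_family C F S x \<longrightarrow>
      (\<exists>!y. y \<in> PObj F B \<and> (\<forall>f\<in>S. PMap F f y = x f)))"

text \<open>\<open>A \<rightarrow> D\<close> followed by the parallel pair \<open>g, h\<close> on \<open>D\<close> is an equalizer in the category
  of sets; lemma \<open>set_equalizer_iff_universal\<close> is the universal property. It is stated for
  test sets in an arbitrary type because HOL cannot quantify over types in a definition.\<close>

definition set_equalizer ::
  "'u set \<Rightarrow> ('u \<Rightarrow> 'v) \<Rightarrow> 'v set \<Rightarrow> ('v \<Rightarrow> 'w) \<Rightarrow> ('v \<Rightarrow> 'w) \<Rightarrow> bool" where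
  "set_equalizer A e D g h \<longleftrightarrow> bij_betw e A {x \<in> D. g x = h x}"

lemma set_equalizer_iff_universal:
  "set_equalizer A e D g h \<longleftrightarrow>
    e \<in> A \<rightarrow> D \<and> (\<forall>a\<in>A. g (e a) = h (e a)) \<and>
    (\<forall>(T :: 't set) u. u \<in> T \<rightarrow> D \<and> (\<forall>t\<in>T. g (u t) = h (u t)) \<longrightarrow>
      (\<exists>!w. w \<in> T \<rightarrow>\<^sub>E A \<and> (\<forall>t\<in>T. e (w t) = u t)))" (is "?L \<longleftrightarrow> ?R")
proof
  assume L: ?L
  then have inj: "inj_on e A" and im: "e ` A = {x \<in> D. g x = h x}"
    unfolding set_equalizer_def bij_betw_def by auto
  have "\<exists>!w. w \<in> T \<rightarrow>\<^sub>E A \<and> (\<forall>t\<in>T. e (w t) = u t)"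
    if u: "u \<in> T \<rightarrow> D" "\<forall>t\<in>T. g (u t) = h (u t)" for T :: "'t set" and u
  proof -
    have ex: "\<forall>t\<in>T. \<exists>a\<in>A. e a = u t"
    proof
      fix t assume "t \<in> T"
      then have "u t \<in> e ` A" unfolding im using u by auto
      then show "\<exists>a\<in>A. e a = u t" by force
    qed
    then obtain w where w: "\<forall>t\<in>T. w t \<in> A \<and> e (w t) = u t" by metis
    show ?thesis
    proof (rule ex1I[of _ "restrict w T"])
      show "restrict w T \<in> T \<rightarrow>\<^sub>E A \<and> (\<forall>t\<in>T. e (restrict w T t) = u t)" using w by auto
    next
      fix v assume v: "v \<in> T \<rightarrow>\<^sub>E A \<and> (\<forall>t\<in>T. e (v t) = u t)"
      show "v = restrict w T"
      proof
        fix t show "v t = restrict w T t"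
        proof (cases "t \<in> T")
          case True
          then have "v t \<in> A" "e (v t) = e (w t)" "w t \<in> A" using v w by auto
          then show ?thesis using inj True by (auto dest: inj_onD)
        next
          case False
          then show ?thesis using v by (auto simp: PiE_def extensional_def)
        qed
      qed
    qed
  qed
  then show ?R using im by auto
next
  assume R: ?R
  have e: "e a \<in> D \<and> g (e a) = h (e a)" if "a \<in> A" for a
    using R that by auto
  have univ: "\<exists>!w. w \<in> T \<rightarrow>\<^sub>E A \<and> (\<forall>t\<in>T. e (w t) = u t)"
    if "u \<in> T \<rightarrow> D" "\<forall>t\<in>T. g (u t) = h (u t)" for T :: "'t set" and u
    by (rule mp[OF spec[OF spec[OF conjunct2[OF conjunct2[OF R]]]]]) (use that in simp)
  let ?t = "undefined :: 't"
  have pt: "\<exists>!w. w \<in> {?t} \<rightarrow>\<^sub>E A \<and> (\<forall>t\<in>{?t}. e (w t) = x)" if "x \<in> D" "g x = h x" for x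
    by (rule univ[of "\<lambda>_. x"]) (use that in simp_all)
  have "inj_on e A"
  proof (rule inj_onI)
    fix a b assume ab: "a \<in> A" "b \<in> A" "e a = e b"
    let ?w = "\<lambda>c. restrict (\<lambda>_. c) {?t}"
    let ?P = "\<lambda>w. w \<in> {?t} \<rightarrow>\<^sub>E A \<and> (\<forall>t\<in>{?t}. e (w t) = e a)"
    have ex1: "\<exists>!w. ?P w" by (rule pt) (use e[OF ab(1)] in simp_all)
    have Pa: "?P (?w a)" using ab by simp
    have Pb: "?P (?w b)" using ab by simp
    have "?w a = ?w b"
      by (rule trans[OF sym[OF the1_equality[where P = ?P, OF ex1 Pa]]
        the1_equality[where P = ?P, OF ex1 Pb]])
    then have "?w a ?t = ?w b ?t" by (rule fun_cong)
    then show "a = b" by simp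
  qed
  moreover have "e ` A = {x \<in> D. g x = h x}"
  proof (intro equalityI subsetI)
    fix x assume "x \<in> {x \<in> D. g x = h x}"
    then have "\<exists>w. w \<in> {?t} \<rightarrow>\<^sub>E A \<and> (\<forall>t\<in>{?t}. e (w t) = x)"
      by (intro ex1_implies_ex[OF pt]) simp_all
    then obtain w where "w ?t \<in> A" "x = e (w ?t)" using PiE_mem by fastforce
    then show "x \<in> e ` A" by auto
  qed (use e in auto)
  ultimately show ?L unfolding set_equalizer_def bij_betw_def by blast
qed

definition preserves_finite_products :: "('o, 'a) cat \<Rightarrow> ('o, 'a, 'v) psh \<Rightarrow> bool" where
  "preserves_finite_products C F \<longleftrightarrow>
    (\<forall>(I :: nat set) T Q \<iota>. finite I \<and> (\<forall>i\<in>I. T i \<in> Obj C) \<and> is_coproduct C I T Q \<iota> \<longrightarrow>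
      bij_betw (\<lambda>x. \<lambda>i\<in>I. PMap F (\<iota> i) x) (PObj F Q) (\<Pi>\<^sub>E i\<in>I. PObj F (T i)))"

end

theory Submission
  imports Defs
begin

text \<open>
  A coherent sheaf glues along every finite effective epimorphic family. An effective
  epimorphism \<open>\<pi>\<close> is such a family with one member, and compatibility over \<open>\<pi>\<close> can be tested
  on the kernel pair, which gives the equalizer condition. The coprojections of a finite
  coproduct are another such family, and for them every choice of sections is compatible:
  by extensivity coprojections are monic, and two maps into different summands that agree in
  the coproduct have an initial domain (\<open>coprojections_compatible\<close>), over which a coherent
  sheaf has only one section because the empty family covers an initial object. So coherent
  sheaves preserve finite products.

  Conversely, let \<open>F\<close> satisfy descent along effective epimorphisms and preserve finite products.
  A finite effective epimorphic family \<open>f\<^sub>i\<close> is one effective epimorphism \<open>\<pi>\<close> out of a coproduct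
  composed with the coprojections \<open>\<iota>\<^sub>i\<close> (\<open>effective_epi_of_family\<close>), so its sieve belongs to the
  sieves that contain all \<open>\<pi> \<iota>\<^sub>i\<close> for some such \<open>\<pi>\<close>. Sieves of this kind are stable under
  pullback (\<open>coproduct_cover_pullback\<close>): preregularity lifts a map into the base to the
  coproduct after an effective epimorphism, and extensivity splits the new source along the
  summands (\<open>coproduct_pullback\<close>). For each of them \<open>F\<close> has unique amalgamations
  (\<open>sheaf_for_coproduct_cover\<close>): glue over the summands by product preservation, then descend
  along \<open>\<pi>\<close>, where compatibility is checked after splitting the test object twice along the
  summands.

  It remains to pass from these sieves to the topology that they generate. The sieves for which
  \<open>F\<close> has unique amalgamations after every pullback form a Grothendieck topology
  (\<open>grothendieck_topology_finest\<close>). It contains the sieves of finite effective epimorphic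
  families by pullback stability, hence all coherent coverings, since the coherent topology is
  the smallest one with that property.
\<close>

section \<open>Initial objects, pullbacks and finite coproducts\<close>

definition initial :: "('o, 'a) cat \<Rightarrow> 'o \<Rightarrow> bool" where
  "initial C Q \<longleftrightarrow> Q \<in> Obj C \<and> (\<forall>W\<in>Obj C. \<exists>!d. d \<in> Hom C Q W)"

lemma empty_coproduct_iff_initial: "is_coproduct C {} T Q \<iota> \<longleftrightarrow> initial C Q"
  by (simp add: is_coproduct_def initial_def)

lemma initial_unique:
  "initial C Q \<Longrightarrow> W \<in> Obj C \<Longrightarrow> d \<in> Hom C Q W \<Longrightarrow> d' \<in> Hom C Q W \<Longrightarrow> d = d'"
  unfolding initial_def by blast

lemma initial_map:
  assumes "initial C Q" "W \<in> Obj C" obtains d where "d \<in> Hom C Q W"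
  using assms unfolding initial_def by blast

lemma binary_coproduct_iff:
  "is_binary_coproduct C X Y Q i j \<longleftrightarrow>
    Q \<in> Obj C \<and> i \<in> Hom C X Q \<and> j \<in> Hom C Y Q \<and>
    (\<forall>W\<in>Obj C. \<forall>a\<in>Hom C X W. \<forall>b\<in>Hom C Y W.
      \<exists>!d. d \<in> Hom C Q W \<and> d \<cdot>\<^bsub>C\<^esub> i = a \<and> d \<cdot>\<^bsub>C\<^esub> j = b)"
proof -
  have fn: "(\<forall>e :: bool \<Rightarrow> 'b. P (e True) (e False)) \<longleftrightarrow> (\<forall>a b. P a b)" for P
  proof
    assume "\<forall>e :: bool \<Rightarrow> 'b. P (e True) (e False)"
    then have "P (case_bool a b True) (case_bool a b False)" for a b by blast
    then show "\<forall>a b. P a b" by simp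
  qed simp
  have "(\<forall>e. (\<forall>k\<in>UNIV. e k \<in> Hom C (case_bool X Y k) W) \<longrightarrow>
      (\<exists>!d. d \<in> Hom C Q W \<and> (\<forall>k\<in>UNIV. d \<cdot>\<^bsub>C\<^esub> case_bool i j k = e k))) \<longleftrightarrow>
    (\<forall>a\<in>Hom C X W. \<forall>b\<in>Hom C Y W.
      \<exists>!d. d \<in> Hom C Q W \<and> d \<cdot>\<^bsub>C\<^esub> i = a \<and> d \<cdot>\<^bsub>C\<^esub> j = b)" for W
    using fn[of "\<lambda>a b. a \<in> Hom C X W \<and> b \<in> Hom C Y W \<longrightarrow>
      (\<exists>!d. d \<in> Hom C Q W \<and> d \<cdot>\<^bsub>C\<^esub> i = a \<and> d \<cdot>\<^bsub>C\<^esub> j = b)"]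
    by (simp add: UNIV_bool conj_commute) blast
  then show ?thesis
    unfolding is_binary_coproduct_def is_coproduct_def
    by (simp add: UNIV_bool) blast
qed

text \<open>Binary coproducts are indexed by the booleans, while the existence of pullbacks along
  coprojections speaks of families indexed by natural numbers; this reindexing connects them.\<close>

lemma coproduct_of_two_iff:
  "is_coproduct C {0, 1 :: nat} (\<lambda>k. if k = 0 then X else Y) Q (\<lambda>k. if k = 0 then i else j)
    \<longleftrightarrow> is_binary_coproduct C X Y Q i j"
proof -
  have fn: "(\<forall>e :: nat \<Rightarrow> 'b. P (e 0) (e 1)) \<longleftrightarrow> (\<forall>a b. P a b)" for P
  proof
    assume *: "\<forall>e :: nat \<Rightarrow> 'b. P (e 0) (e 1)"
    have "P a b" for a b using *[rule_format, of "\<lambda>k. if k = 0 then a else b"] by simp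
    then show "\<forall>a b. P a b" by blast
  qed simp
  have "(\<forall>e. e 0 \<in> Hom C X W \<and> e 1 \<in> Hom C Y W \<longrightarrow>
      (\<exists>!d. d \<in> Hom C Q W \<and> d \<cdot>\<^bsub>C\<^esub> i = e 0 \<and> d \<cdot>\<^bsub>C\<^esub> j = e (1::nat))) \<longleftrightarrow>
    (\<forall>a\<in>Hom C X W. \<forall>b\<in>Hom C Y W.
      \<exists>!d. d \<in> Hom C Q W \<and> d \<cdot>\<^bsub>C\<^esub> i = a \<and> d \<cdot>\<^bsub>C\<^esub> j = b)" for W
    using fn[of "\<lambda>a b. a \<in> Hom C X W \<and> b \<in> Hom C Y W \<longrightarrow>
      (\<exists>!d. d \<in> Hom C Q W \<and> d \<cdot>\<^bsub>C\<^esub> i = a \<and> d \<cdot>\<^bsub>C\<^esub> j = b)"]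
    by blast
  then show ?thesis
    unfolding binary_coproduct_iff is_coproduct_def by simp
qed

context category begin

lemma Hom_Obj: "f \<in> Hom C X Y \<Longrightarrow> X \<in> Obj C" "f \<in> Hom C X Y \<Longrightarrow> Y \<in> Obj C"
  using Dom_Obj Cod_Obj unfolding Hom_def by auto

lemma coproduct_Hom: "is_coproduct C I T Q \<iota> \<Longrightarrow> i \<in> I \<Longrightarrow> \<iota> i \<in> Hom C (T i) Q"
  unfolding is_coproduct_def by blast

lemma coproduct_Obj: "is_coproduct C I T Q \<iota> \<Longrightarrow> i \<in> I \<Longrightarrow> T i \<in> Obj C"
  by (rule Hom_Obj(1)[OF coproduct_Hom])

lemma finite_coproduct_exists:
  assumes "finitary_extensive C" "finite (I :: nat set)" "\<And>i. i \<in> I \<Longrightarrow> T i \<in> Obj C"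
  obtains Q \<iota> where "is_coproduct C I T Q \<iota>"
proof -
  have "has_finite_coproducts C" using assms(1) unfolding finitary_extensive_def by blast
  moreover have "finite I \<and> (\<forall>i\<in>I. T i \<in> Obj C)" using assms(2,3) by blast
  ultimately have "\<exists>Q \<iota>. is_coproduct C I T Q \<iota>" unfolding has_finite_coproducts_def by blast
  then show ?thesis using that by blast
qed

lemma coproduct_factor:
  assumes "is_coproduct C I T Q \<iota>" "W \<in> Obj C" "\<And>i. i \<in> I \<Longrightarrow> e i \<in> Hom C (T i) W"
  obtains d where "d \<in> Hom C Q W" "\<And>i. i \<in> I \<Longrightarrow> d \<cdot>\<^bsub>C\<^esub> \<iota> i = e i"
proof -
  have "\<exists>!d. d \<in> Hom C Q W \<and> (\<forall>i\<in>I. d \<cdot>\<^bsub>C\<^esub> \<iota> i = e i)"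
    using assms unfolding is_coproduct_def by blast
  then show ?thesis using that by blast
qed

lemma coproduct_jointly_epi:
  assumes c: "is_coproduct C I T Q \<iota>" and d: "d \<in> Hom C Q W" "d' \<in> Hom C Q W"
    and eq: "\<And>i. i \<in> I \<Longrightarrow> d \<cdot>\<^bsub>C\<^esub> \<iota> i = d' \<cdot>\<^bsub>C\<^esub> \<iota> i"
  shows "d = d'"
proof -
  have W: "W \<in> Obj C" using Hom_Obj(2)[OF d(1)] .
  have "\<forall>i\<in>I. d' \<cdot>\<^bsub>C\<^esub> \<iota> i \<in> Hom C (T i) W" using Comp_Hom[OF coproduct_Hom[OF c] d(2)] by blast
  then have "\<exists>!m. m \<in> Hom C Q W \<and> (\<forall>i\<in>I. m \<cdot>\<^bsub>C\<^esub> \<iota> i = d' \<cdot>\<^bsub>C\<^esub> \<iota> i)"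
    using c W unfolding is_coproduct_def
    by (auto dest!: bspec[of _ _ W] spec[of _ "\<lambda>i. d' \<cdot>\<^bsub>C\<^esub> \<iota> i"])
  then show ?thesis using d eq by blast
qed

lemma pullback_factor:
  assumes "is_pullback C p q f g" "f \<in> Hom C X B" "g \<in> Hom C Y B"
    "u \<in> Hom C Z X" "v \<in> Hom C Z Y" "f \<cdot>\<^bsub>C\<^esub> u = g \<cdot>\<^bsub>C\<^esub> v"
  obtains w where "w \<in> Hom C Z (Dom C p)" "p \<cdot>\<^bsub>C\<^esub> w = u" "q \<cdot>\<^bsub>C\<^esub> w = v"
proof -
  have X: "X' = X" if "f \<in> Hom C X' B'" for X' B' using that assms(2) by (simp add: Hom_def)
  have Y: "Y' = Y" if "g \<in> Hom C Y' B'" for Y' B' using that assms(3) by (simp add: Hom_def)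
  have Z: "Z \<in> Obj C" using Hom_Obj(1)[OF assms(4)] .
  obtain P where "p \<in> Hom C P X" and
    *: "\<forall>Z\<in>Obj C. \<forall>u\<in>Hom C Z X. \<forall>v\<in>Hom C Z Y. f \<cdot>\<^bsub>C\<^esub> u = g \<cdot>\<^bsub>C\<^esub> v \<longrightarrow>
        (\<exists>!w. w \<in> Hom C Z P \<and> p \<cdot>\<^bsub>C\<^esub> w = u \<and> q \<cdot>\<^bsub>C\<^esub> w = v)"
    using assms(1) X Y unfolding is_pullback_def by blast
  then have "P = Dom C p" by (simp add: Hom_def)
  with * Z assms(4-6) have "\<exists>!w. w \<in> Hom C Z (Dom C p) \<and> p \<cdot>\<^bsub>C\<^esub> w = u \<and> q \<cdot>\<^bsub>C\<^esub> w = v" by blast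
  then show ?thesis using that by blast
qed

lemma pullback_legs:
  assumes "is_pullback C p q f g" "f \<in> Hom C X B" "g \<in> Hom C Y B"
  shows "p \<in> Hom C (Dom C p) X" "q \<in> Hom C (Dom C p) Y" "f \<cdot>\<^bsub>C\<^esub> p = g \<cdot>\<^bsub>C\<^esub> q"
  using assms unfolding is_pullback_def by (auto simp: Hom_def)

text \<open>Splitting off one summand reduces statements about finite coproducts to the binary
  coproducts in terms of which extensivity is phrased; \<open>coproduct_insert\<close> reassembles them.\<close>

lemma coproduct_split:
  assumes Q: "is_coproduct C (insert n I) T Q \<iota>" and n: "n \<notin> I" and R: "is_coproduct C I T R \<rho>"
  obtains j where "is_binary_coproduct C (T n) R Q (\<iota> n) j" "\<And>i. i \<in> I \<Longrightarrow> j \<cdot>\<^bsub>C\<^esub> \<rho> i = \<iota> i"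
proof -
  have QO: "Q \<in> Obj C" and \<iota>: "\<And>i. i \<in> insert n I \<Longrightarrow> \<iota> i \<in> Hom C (T i) Q"
    and \<rho>: "\<And>i. i \<in> I \<Longrightarrow> \<rho> i \<in> Hom C (T i) R"
    using Q R unfolding is_coproduct_def by blast+
  obtain j where j: "j \<in> Hom C R Q" "\<And>i. i \<in> I \<Longrightarrow> j \<cdot>\<^bsub>C\<^esub> \<rho> i = \<iota> i"
    using coproduct_factor[OF R QO, of \<iota>] \<iota> by blast
  have "is_binary_coproduct C (T n) R Q (\<iota> n) j"
    unfolding binary_coproduct_iff
  proof (intro conjI ballI)
    fix W a b assume W: "W \<in> Obj C" and a: "a \<in> Hom C (T n) W" and b: "b \<in> Hom C R W"
    let ?e = "\<lambda>i. if i = n then a else b \<cdot>\<^bsub>C\<^esub> \<rho> i"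
    have "?e i \<in> Hom C (T i) W" if "i \<in> insert n I" for i
      using that a Comp_Hom[OF \<rho> b] by auto
    then obtain d where d: "d \<in> Hom C Q W" "\<And>i. i \<in> insert n I \<Longrightarrow> d \<cdot>\<^bsub>C\<^esub> \<iota> i = ?e i"
      using coproduct_factor[OF Q W, of ?e] by blast
    have "(d \<cdot>\<^bsub>C\<^esub> j) \<cdot>\<^bsub>C\<^esub> \<rho> i = b \<cdot>\<^bsub>C\<^esub> \<rho> i" if "i \<in> I" for i
    proof -
      have "(d \<cdot>\<^bsub>C\<^esub> j) \<cdot>\<^bsub>C\<^esub> \<rho> i = d \<cdot>\<^bsub>C\<^esub> \<iota> i"
        using Comp_assoc[OF \<rho>[OF that] j(1) d(1)] j(2)[OF that] by simp
      also have "\<dots> = b \<cdot>\<^bsub>C\<^esub> \<rho> i" using d(2)[of i] that n by auto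
      finally show ?thesis .
    qed
    then have dj: "d \<cdot>\<^bsub>C\<^esub> j = b"
      by (rule coproduct_jointly_epi[OF R Comp_Hom[OF j(1) d(1)] b])
    show "\<exists>!d. d \<in> Hom C Q W \<and> d \<cdot>\<^bsub>C\<^esub> \<iota> n = a \<and> d \<cdot>\<^bsub>C\<^esub> j = b"
    proof (rule ex1I[of _ d])
      show "d \<in> Hom C Q W \<and> d \<cdot>\<^bsub>C\<^esub> \<iota> n = a \<and> d \<cdot>\<^bsub>C\<^esub> j = b" using d dj by simp
    next
      fix d' assume d': "d' \<in> Hom C Q W \<and> d' \<cdot>\<^bsub>C\<^esub> \<iota> n = a \<and> d' \<cdot>\<^bsub>C\<^esub> j = b"
      have "d' \<cdot>\<^bsub>C\<^esub> \<iota> i = d \<cdot>\<^bsub>C\<^esub> \<iota> i" if i: "i \<in> insert n I" for i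
      proof (cases "i = n")
        case False
        then have iI: "i \<in> I" using i by simp
        have "d' \<cdot>\<^bsub>C\<^esub> \<iota> i = (d' \<cdot>\<^bsub>C\<^esub> j) \<cdot>\<^bsub>C\<^esub> \<rho> i"
          using Comp_assoc[OF \<rho>[OF iI] j(1), of d' W] d' j(2)[OF iI] by simp
        then show ?thesis using d' d(2)[OF i] False by simp
      qed (use d' d(2)[OF i] in simp)
      then show "d' = d" using coproduct_jointly_epi[OF Q _ d(1)] d' by blast
    qed
  qed (use \<iota> j QO in auto)
  then show ?thesis using j(2) that by blast
qed

lemma coproduct_insert:
  assumes Q: "is_binary_coproduct C A R Q a j" and n: "n \<notin> I" and R: "is_coproduct C I T R \<rho>"
  shows "is_coproduct C (insert n I) (T(n := A)) Q (\<lambda>i. if i = n then a else j \<cdot>\<^bsub>C\<^esub> \<rho> i)"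
proof -
  have QO: "Q \<in> Obj C" and a: "a \<in> Hom C A Q" and j: "j \<in> Hom C R Q"
    and \<rho>: "\<And>i. i \<in> I \<Longrightarrow> \<rho> i \<in> Hom C (T i) R"
    using Q R unfolding binary_coproduct_iff is_coproduct_def by blast+
  have jr: "j \<cdot>\<^bsub>C\<^esub> \<rho> i \<in> Hom C (T i) Q" if "i \<in> I" for i using Comp_Hom[OF \<rho>[OF that] j] .
  show ?thesis
    unfolding is_coproduct_def
  proof (intro conjI ballI allI impI)
    fix i assume "i \<in> insert n I"
    then show "(if i = n then a else j \<cdot>\<^bsub>C\<^esub> \<rho> i) \<in> Hom C ((T(n := A)) i) Q" using a jr by auto
  next
    fix W e assume W: "W \<in> Obj C" and e: "\<forall>i\<in>insert n I. e i \<in> Hom C ((T(n := A)) i) W"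
    have en: "e n \<in> Hom C A W" and eI: "\<And>i. i \<in> I \<Longrightarrow> e i \<in> Hom C (T i) W"
      using e n by (auto split: if_splits)
    obtain b where b: "b \<in> Hom C R W" "\<And>i. i \<in> I \<Longrightarrow> b \<cdot>\<^bsub>C\<^esub> \<rho> i = e i"
      using coproduct_factor[OF R W, of e] eI by blast
    have ex1: "\<exists>!d. d \<in> Hom C Q W \<and> d \<cdot>\<^bsub>C\<^esub> a = e n \<and> d \<cdot>\<^bsub>C\<^esub> j = b"
      using Q W en b(1) unfolding binary_coproduct_iff by blast
    have "(\<forall>i\<in>insert n I. d \<cdot>\<^bsub>C\<^esub> (if i = n then a else j \<cdot>\<^bsub>C\<^esub> \<rho> i) = e i) \<longleftrightarrow>
        d \<cdot>\<^bsub>C\<^esub> a = e n \<and> d \<cdot>\<^bsub>C\<^esub> j = b" if d: "d \<in> Hom C Q W" for d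
    proof -
      have "d \<cdot>\<^bsub>C\<^esub> j = b \<longleftrightarrow> (\<forall>i\<in>I. (d \<cdot>\<^bsub>C\<^esub> j) \<cdot>\<^bsub>C\<^esub> \<rho> i = b \<cdot>\<^bsub>C\<^esub> \<rho> i)"
        using coproduct_jointly_epi[OF R Comp_Hom[OF j d] b(1)] by auto
      also have "\<dots> \<longleftrightarrow> (\<forall>i\<in>I. d \<cdot>\<^bsub>C\<^esub> (j \<cdot>\<^bsub>C\<^esub> \<rho> i) = e i)"
        using b(2) Comp_assoc[OF \<rho> j d] by simp
      finally show ?thesis using n by auto
    qed
    then show "\<exists>!d. d \<in> Hom C Q W \<and>
        (\<forall>i\<in>insert n I. d \<cdot>\<^bsub>C\<^esub> (if i = n then a else j \<cdot>\<^bsub>C\<^esub> \<rho> i) = e i)"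
      using ex1 by (smt (verit, ccfv_threshold))
  qed (rule QO)
qed


section \<open>Consequences of extensivity\<close>

lemma extensive_iff:
  assumes "finitary_extensive C" "is_binary_coproduct C X Y Q i j"
    "z1 \<in> Hom C Z1 Z" "z2 \<in> Hom C Z2 Z"
    "a \<in> Hom C Z1 X" "c \<in> Hom C Z Q" "b \<in> Hom C Z2 Y"
    "i \<cdot>\<^bsub>C\<^esub> a = c \<cdot>\<^bsub>C\<^esub> z1" "j \<cdot>\<^bsub>C\<^esub> b = c \<cdot>\<^bsub>C\<^esub> z2"
  shows "is_pullback C a z1 i c \<and> is_pullback C b z2 j c \<longleftrightarrow> is_binary_coproduct C Z1 Z2 Z z1 z2"
  using assms unfolding finitary_extensive_def by blast

lemma initial_exists:
  assumes "finitary_extensive C"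
  obtains E where "initial C E"
proof -
  have "\<exists>Q \<iota>. is_coproduct C ({} :: nat set) undefined Q \<iota>"
    using assms unfolding finitary_extensive_def has_finite_coproducts_def by simp
  then show ?thesis using that unfolding empty_coproduct_iff_initial by blast
qed

text \<open>For \<open>X = E\<close> this presents an initial object as \<open>E = E + E\<close> with identities as coprojections,
  which yields strictness; for a summand \<open>X\<close> of a coproduct it is the diagram on which extensivity
  is tested to see that coprojections are monic and disjoint.\<close>

lemma initial_coproduct_unit:
  assumes E: "initial C E" and o: "z \<in> Hom C E X"
  shows "is_binary_coproduct C X E X (Id C X) z"
  unfolding binary_coproduct_iff
proof (intro conjI ballI)
  show XO: "X \<in> Obj C" using Hom_Obj(2)[OF o] .
  show "Id C X \<in> Hom C X X" using Id_Hom[OF XO] .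
  fix V a b assume V: "V \<in> Obj C" and a: "a \<in> Hom C X V" and b: "b \<in> Hom C E V"
  have "a \<cdot>\<^bsub>C\<^esub> z = b" using initial_unique[OF E V Comp_Hom[OF o a] b] .
  then have "a \<in> Hom C X V \<and> a \<cdot>\<^bsub>C\<^esub> Id C X = a \<and> a \<cdot>\<^bsub>C\<^esub> z = b"
    using a Comp_Id[OF a] by blast
  moreover have "d = a" if "d \<in> Hom C X V \<and> d \<cdot>\<^bsub>C\<^esub> Id C X = a \<and> d \<cdot>\<^bsub>C\<^esub> z = b" for d
    using that Comp_Id[of d X V] by metis
  ultimately show "\<exists>!d. d \<in> Hom C X V \<and> d \<cdot>\<^bsub>C\<^esub> Id C X = a \<and> d \<cdot>\<^bsub>C\<^esub> z = b" by blast
qed (rule o)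

text \<open>Initial objects are strict: pulling the coproduct diagram \<open>Q = Q + Q\<close> back along
  \<open>k : W \<rightarrow> Q\<close> exhibits \<open>W\<close> as \<open>W + W\<close> with identities as coprojections. Hence any two maps out
  of \<open>W\<close> agree, as both are the copairing of one with the other, and one exists through \<open>Q\<close>.\<close>

lemma initial_strict:
  assumes ext: "finitary_extensive C" and Q: "initial C Q" and k: "k \<in> Hom C W Q"
  shows "initial C W"
proof -
  have QO: "Q \<in> Obj C" and WO: "W \<in> Obj C" using Hom_Obj[OF k] by blast+
  note idQ = Id_Hom[OF QO] and idW = Id_Hom[OF WO]
  have "is_binary_coproduct C Q Q Q (Id C Q) (Id C Q)" using initial_coproduct_unit[OF Q idQ] .
  moreover have "is_pullback C k (Id C W) (Id C Q) k"
    unfolding is_pullback_def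
  proof (intro exI conjI ballI impI)
    show "k \<in> Hom C W Q" "Id C W \<in> Hom C W W" "Id C Q \<in> Hom C Q Q" "k \<in> Hom C W Q"
      using k idW idQ by auto
    show "Id C Q \<cdot>\<^bsub>C\<^esub> k = k \<cdot>\<^bsub>C\<^esub> Id C W" using Comp_Id[OF k] Id_Comp[OF k] by simp
    fix Z u v assume u: "u \<in> Hom C Z Q" and v: "v \<in> Hom C Z W" and
      eq: "Id C Q \<cdot>\<^bsub>C\<^esub> u = k \<cdot>\<^bsub>C\<^esub> v"
    have 1: "v \<in> Hom C Z W \<and> k \<cdot>\<^bsub>C\<^esub> v = u \<and> Id C W \<cdot>\<^bsub>C\<^esub> v = v"
      using Id_Comp[OF u] Id_Comp[OF v] eq v by simp
    have 2: "w = v" if "w \<in> Hom C Z W \<and> k \<cdot>\<^bsub>C\<^esub> w = u \<and> Id C W \<cdot>\<^bsub>C\<^esub> w = v" for w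
      using that Id_Comp[of w Z W] by simp
    show "\<exists>!w. w \<in> Hom C Z W \<and> k \<cdot>\<^bsub>C\<^esub> w = u \<and> Id C W \<cdot>\<^bsub>C\<^esub> w = v"
      by (rule ex1I[of _ v]) (rule 1, rule 2)
  qed
  ultimately have W2: "is_binary_coproduct C W W W (Id C W) (Id C W)"
    using extensive_iff[OF ext _ idW idW k k k] Comp_Id[OF k] Id_Comp[OF k] by metis
  show ?thesis
    unfolding initial_def
  proof (intro conjI ballI)
    fix V assume V: "V \<in> Obj C"
    obtain d where d: "d \<in> Hom C Q V" using initial_map[OF Q V] .
    show "\<exists>!e. e \<in> Hom C W V"
    proof (rule ex1I[of _ "d \<cdot>\<^bsub>C\<^esub> k"])
      show dk: "d \<cdot>\<^bsub>C\<^esub> k \<in> Hom C W V" using Comp_Hom[OF k d] .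
      fix e assume e: "e \<in> Hom C W V"
      obtain m where "m \<in> Hom C W V" "m \<cdot>\<^bsub>C\<^esub> Id C W = e" "m \<cdot>\<^bsub>C\<^esub> Id C W = d \<cdot>\<^bsub>C\<^esub> k"
        using W2 V e dk unfolding binary_coproduct_iff by blast
      then show "e = d \<cdot>\<^bsub>C\<^esub> k" by simp
    qed
  qed (rule WO)
qed

text \<open>Since \<open>X = X + 0\<close>, extensivity applied to this coproduct over \<open>Q = X + Y\<close> says that its two
  squares are pullbacks. The square of \<open>X\<close> against \<open>i\<close> says that \<open>i\<close> is monic; the square of the
  initial object against \<open>j\<close> says that \<open>X\<close> and \<open>Y\<close> have initial intersection in \<open>Q\<close>.\<close>

lemma binary_coprojections:
  assumes ext: "finitary_extensive C" and Q: "is_binary_coproduct C X Y Q i j"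
  shows binary_coprojection_mono:
      "u \<in> Hom C Z X \<Longrightarrow> v \<in> Hom C Z X \<Longrightarrow> i \<cdot>\<^bsub>C\<^esub> u = i \<cdot>\<^bsub>C\<^esub> v \<Longrightarrow> u = v"
    and binary_coprojections_disjoint:
      "v \<in> Hom C Z X \<Longrightarrow> u \<in> Hom C Z Y \<Longrightarrow> i \<cdot>\<^bsub>C\<^esub> v = j \<cdot>\<^bsub>C\<^esub> u \<Longrightarrow> initial C Z"
proof -
  have QO: "Q \<in> Obj C" and i: "i \<in> Hom C X Q" and j: "j \<in> Hom C Y Q"
    using Q unfolding binary_coproduct_iff by blast+
  obtain E where E: "initial C E" using initial_exists[OF ext] .
  have XO: "X \<in> Obj C" using Hom_Obj[OF i] by blast
  note idX = Id_Hom[OF XO]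
  obtain oX where oX: "oX \<in> Hom C E X" using initial_map[OF E XO] .
  obtain oY where oY: "oY \<in> Hom C E Y" using initial_map[OF E Hom_Obj(1)[OF j]] .
  have "is_binary_coproduct C X E X (Id C X) oX" using initial_coproduct_unit[OF E oX] .
  moreover have "j \<cdot>\<^bsub>C\<^esub> oY = i \<cdot>\<^bsub>C\<^esub> oX"
    using initial_unique[OF E QO Comp_Hom[OF oY j] Comp_Hom[OF oX i]] .
  ultimately have pb: "is_pullback C (Id C X) (Id C X) i i" "is_pullback C oY oX j i"
    using extensive_iff[OF ext Q idX oX idX i oY] by blast+
  show "u = v" if uv: "u \<in> Hom C Z X" "v \<in> Hom C Z X" "i \<cdot>\<^bsub>C\<^esub> u = i \<cdot>\<^bsub>C\<^esub> v"
  proof -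
    obtain w where w: "w \<in> Hom C Z (Dom C (Id C X))" "Id C X \<cdot>\<^bsub>C\<^esub> w = u" "Id C X \<cdot>\<^bsub>C\<^esub> w = v"
      using pullback_factor[OF pb(1) i i uv] .
    then show ?thesis by simp
  qed
  show "initial C Z" if vu: "v \<in> Hom C Z X" "u \<in> Hom C Z Y" "i \<cdot>\<^bsub>C\<^esub> v = j \<cdot>\<^bsub>C\<^esub> u"
  proof -
    obtain w where "w \<in> Hom C Z (Dom C oY)"
      using pullback_factor[OF pb(2) j i vu(2,1) vu(3)[symmetric]] .
    then have "w \<in> Hom C Z E" using oY by (simp add: Hom_def)
    then show ?thesis by (rule initial_strict[OF ext E])
  qed
qed

text \<open>Any choice of sections over the summands is compatible, up to what happens over an initial
  object. The index \<open>i\<close> is split off, so that the binary case applies to \<open>T i\<close> and the coproduct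
  of all other summands.\<close>

lemma coprojections_compatible:
  assumes ext: "finitary_extensive C" and fin: "finite (I :: nat set)"
    and Q: "is_coproduct C I T Q \<iota>"
    and i: "i \<in> I" and j: "j \<in> I" and u: "u \<in> Hom C Z (T i)" and v: "v \<in> Hom C Z (T j)"
    and eq: "\<iota> i \<cdot>\<^bsub>C\<^esub> u = \<iota> j \<cdot>\<^bsub>C\<^esub> v"
  shows "i = j \<and> u = v \<or> initial C Z"
proof -
  obtain R \<rho> where R: "is_coproduct C (I - {i}) T R \<rho>"
    using finite_coproduct_exists[OF ext, of "I - {i}" T] fin coproduct_Obj[OF Q] by blast
  have "insert i (I - {i}) = I" using i by blast
  then obtain k where k: "is_binary_coproduct C (T i) R Q (\<iota> i) k"
    "\<And>l. l \<in> I - {i} \<Longrightarrow> k \<cdot>\<^bsub>C\<^esub> \<rho> l = \<iota> l"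
    using coproduct_split[of i "I - {i}" T Q \<iota> R \<rho>] Q R by auto
  show ?thesis
  proof (cases "i = j")
    case True
    then show ?thesis using binary_coprojection_mono[OF ext k(1) u] v eq by blast
  next
    case False
    then have jI: "j \<in> I - {i}" using j by blast
    have \<rho>: "\<rho> j \<in> Hom C (T j) R" using R jI unfolding is_coproduct_def by blast
    have kH: "k \<in> Hom C R Q" using k(1) unfolding binary_coproduct_iff by blast
    have "\<iota> i \<cdot>\<^bsub>C\<^esub> u = k \<cdot>\<^bsub>C\<^esub> (\<rho> j \<cdot>\<^bsub>C\<^esub> v)"
      using eq Comp_assoc[OF v \<rho> kH] k(2)[OF jI] by simp
    then show ?thesis
      using binary_coprojections_disjoint[OF ext k(1) u Comp_Hom[OF v \<rho>]] by blast
  qed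
qed

lemma binary_coproduct_pullback:
  assumes ext: "finitary_extensive C" and Q: "is_binary_coproduct C X Y Q i j"
    and c: "c \<in> Hom C Z Q"
  obtains Z1 Z2 z1 z2 a b where "is_binary_coproduct C Z1 Z2 Z z1 z2"
    "a \<in> Hom C Z1 X" "b \<in> Hom C Z2 Y" "i \<cdot>\<^bsub>C\<^esub> a = c \<cdot>\<^bsub>C\<^esub> z1" "j \<cdot>\<^bsub>C\<^esub> b = c \<cdot>\<^bsub>C\<^esub> z2"
proof -
  have i: "i \<in> Hom C X Q" and j: "j \<in> Hom C Y Q" using Q unfolding binary_coproduct_iff by blast+
  have Q2: "is_coproduct C {0, 1 :: nat} (\<lambda>k. if k = 0 then X else Y) Q (\<lambda>k. if k = 0 then i else j)"
    using Q unfolding coproduct_of_two_iff .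
  have "\<forall>k\<in>{0, 1 :: nat}. \<forall>Z\<in>Obj C. \<forall>f\<in>Hom C Z Q.
      \<exists>p q. is_pullback C p q (if k = 0 then i else j) f"
    using ext unfolding finitary_extensive_def has_pullbacks_along_coprojections_def
    by (elim conjE allE[of _ "{0, 1 :: nat}"] allE[of _ "\<lambda>k. if k = 0 then X else Y"]
        allE[of _ Q] allE[of _ "\<lambda>k. if k = 0 then i else j"]) (use Q2 in simp)
  then have "\<exists>p q. is_pullback C p q (if k = 0 then i else j) c" if "k \<in> {0, 1 :: nat}" for k
    using that c Hom_Obj(1)[OF c] by blast
  from this[of 0] this[of 1] obtain a z1 b z2 where
    pa: "is_pullback C a z1 i c" and pb: "is_pullback C b z2 j c" by auto
  note A = pullback_legs[OF pa i c] and B = pullback_legs[OF pb j c]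
  have "is_binary_coproduct C (Dom C a) (Dom C b) Z z1 z2"
    using extensive_iff[OF ext Q A(2) B(2) A(1) c B(1) A(3) B(3)] pa pb by blast
  then show ?thesis using that A B by blast
qed

text \<open>Finite coproducts are stable under pullback, proved one summand at a time. The empty case is
  strictness of the initial object.\<close>

lemma coproduct_pullback:
  assumes ext: "finitary_extensive C" and "finite (I :: nat set)"
    and "is_coproduct C I T Q \<iota>" and "k \<in> Hom C W Q"
  shows "\<exists>U w t. is_coproduct C I U W w \<and>
    (\<forall>i\<in>I. t i \<in> Hom C (U i) (T i) \<and> \<iota> i \<cdot>\<^bsub>C\<^esub> t i = k \<cdot>\<^bsub>C\<^esub> w i)"
  using assms(2-4)
proof (induction I arbitrary: Q \<iota> W k rule: finite_induct)
  case empty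
  then have "initial C W" using initial_strict[OF ext] unfolding empty_coproduct_iff_initial by blast
  then show ?case unfolding empty_coproduct_iff_initial by simp
next
  case (insert n I)
  obtain R \<rho> where R: "is_coproduct C I T R \<rho>"
    using finite_coproduct_exists[OF ext insert.hyps(1), of T] coproduct_Obj[OF insert.prems(1)] by blast
  obtain j where j: "is_binary_coproduct C (T n) R Q (\<iota> n) j"
    "\<And>i. i \<in> I \<Longrightarrow> j \<cdot>\<^bsub>C\<^esub> \<rho> i = \<iota> i"
    using coproduct_split[OF insert.prems(1) insert.hyps(2) R] by blast
  obtain Wn WR wn wR tn tR where W: "is_binary_coproduct C Wn WR W wn wR"
    and t: "tn \<in> Hom C Wn (T n)" "tR \<in> Hom C WR R"
      "\<iota> n \<cdot>\<^bsub>C\<^esub> tn = k \<cdot>\<^bsub>C\<^esub> wn" "j \<cdot>\<^bsub>C\<^esub> tR = k \<cdot>\<^bsub>C\<^esub> wR"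
    using binary_coproduct_pullback[OF ext j(1) insert.prems(2)] .
  obtain U w s where U: "is_coproduct C I U WR w"
    and s: "\<And>i. i \<in> I \<Longrightarrow> s i \<in> Hom C (U i) (T i) \<and> \<rho> i \<cdot>\<^bsub>C\<^esub> s i = tR \<cdot>\<^bsub>C\<^esub> w i"
    using insert.IH[OF R t(2)] by blast
  have jH: "j \<in> Hom C R Q" and wR: "wR \<in> Hom C WR W"
    using j(1) W unfolding binary_coproduct_iff by blast+
  let ?U = "U(n := Wn)" and ?w = "\<lambda>i. if i = n then wn else wR \<cdot>\<^bsub>C\<^esub> w i" and ?t = "s(n := tn)"
  have "is_coproduct C (insert n I) ?U W ?w" using coproduct_insert[OF W insert.hyps(2) U] .
  moreover have "?t i \<in> Hom C (?U i) (T i) \<and> \<iota> i \<cdot>\<^bsub>C\<^esub> ?t i = k \<cdot>\<^bsub>C\<^esub> ?w i" if i: "i \<in> insert n I" for i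
  proof (cases "i = n")
    case False
    then have iI: "i \<in> I" using i by simp
    have w: "w i \<in> Hom C (U i) WR" and \<rho>: "\<rho> i \<in> Hom C (T i) R"
      using U R iI unfolding is_coproduct_def by blast+
    have "\<iota> i \<cdot>\<^bsub>C\<^esub> s i = j \<cdot>\<^bsub>C\<^esub> (\<rho> i \<cdot>\<^bsub>C\<^esub> s i)"
      using Comp_assoc[OF _ \<rho> jH] s[OF iI] j(2)[OF iI] by metis
    also have "\<dots> = (j \<cdot>\<^bsub>C\<^esub> tR) \<cdot>\<^bsub>C\<^esub> w i" using Comp_assoc[OF w t(2) jH] s[OF iI] by simp
    also have "\<dots> = k \<cdot>\<^bsub>C\<^esub> (wR \<cdot>\<^bsub>C\<^esub> w i)" using Comp_assoc[OF w wR insert.prems(2)] t(4) by simp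
    finally show ?thesis using s[OF iI] False by simp
  qed (use t in simp)
  ultimately show ?case by blast
qed


end


section \<open>The finest topology making a presheaf a sheaf\<close>

definition sheaf_for ::
  "('o, 'a) cat \<Rightarrow> ('o, 'a, 'v) psh \<Rightarrow> 'o \<Rightarrow> 'a set \<Rightarrow> bool" where
  "sheaf_for C F B S \<longleftrightarrow>
    (\<forall>x. matching_family C F S x \<longrightarrow> (\<exists>!y. y \<in> PObj F B \<and> (\<forall>f\<in>S. PMap F f y = x f)))"

text \<open>Pulling back first makes this a topology: the sheaf condition for a single sieve need
  not pass to its pullbacks. Taking \<open>h\<close> to be an identity shows that \<open>F\<close> is a sheaf for it.\<close>

definition finest_topology ::
  "('o, 'a) cat \<Rightarrow> ('o, 'a, 'v) psh \<Rightarrow> 'o \<Rightarrow> 'a set set" where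
  "finest_topology C F B = {S. is_sieve C B S \<and>
    (\<forall>A\<in>Obj C. \<forall>h\<in>Hom C A B. sheaf_for C F A (pullback_sieve C h S))}"

lemma sheaf_for_amalgamation:
  assumes "sheaf_for C F B S" "matching_family C F S x"
  obtains y where "y \<in> PObj F B" "\<And>f. f \<in> S \<Longrightarrow> PMap F f y = x f"
  using assms unfolding sheaf_for_def by blast

lemma sheaf_forI:
  assumes "\<And>x. matching_family C F S x \<Longrightarrow> \<exists>y\<in>PObj F B. \<forall>f\<in>S. PMap F f y = x f"
    and "\<And>y z. y \<in> PObj F B \<Longrightarrow> z \<in> PObj F B \<Longrightarrow> (\<And>f. f \<in> S \<Longrightarrow> PMap F f y = PMap F f z) \<Longrightarrow> y = z"
  shows "sheaf_for C F B S"
  unfolding sheaf_for_def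
proof (intro allI impI)
  fix x assume "matching_family C F S x"
  then obtain y where y: "y \<in> PObj F B" "\<forall>f\<in>S. PMap F f y = x f" using assms(1) by blast
  show "\<exists>!y. y \<in> PObj F B \<and> (\<forall>f\<in>S. PMap F f y = x f)"
  proof (rule ex1I[of _ y])
    fix z assume "z \<in> PObj F B \<and> (\<forall>f\<in>S. PMap F f z = x f)"
    then show "z = y" using assms(2)[of z y] y by simp
  qed (use y in blast)
qed

context category begin

lemma PMap_PObj:
  assumes "presheaf C F" "f \<in> Hom C X Y" "x \<in> PObj F Y"
  shows "PMap F f x \<in> PObj F X"
  using assms Hom_Obj[OF assms(2)] unfolding presheaf_def by blast

lemma PMap_Id: "presheaf C F \<Longrightarrow> X \<in> Obj C \<Longrightarrow> x \<in> PObj F X \<Longrightarrow> PMap F (Id C X) x = x"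
  unfolding presheaf_def by blast

lemma PMap_Comp:
  assumes "presheaf C F" "f \<in> Hom C X Y" "g \<in> Hom C Y Z" "x \<in> PObj F Z"
  shows "PMap F (g \<cdot>\<^bsub>C\<^esub> f) x = PMap F f (PMap F g x)"
  using assms Hom_Obj[OF assms(2)] Hom_Obj[OF assms(3)] unfolding presheaf_def by blast

lemma sieve_Comp:
  "is_sieve C B S \<Longrightarrow> f \<in> S \<Longrightarrow> f \<in> Hom C X B \<Longrightarrow> g \<in> Hom C Y X \<Longrightarrow> f \<cdot>\<^bsub>C\<^esub> g \<in> S"
  unfolding is_sieve_def Hom_def by auto

lemma sieve_Hom: "is_sieve C B S \<Longrightarrow> f \<in> S \<Longrightarrow> f \<in> Hom C (Dom C f) B"
  unfolding is_sieve_def Hom_def by auto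

lemma matching_PObj:
  "matching_family C F S x \<Longrightarrow> f \<in> S \<Longrightarrow> f \<in> Hom C X B \<Longrightarrow> x f \<in> PObj F X"
  unfolding matching_family_def Hom_def by auto

lemma matching_PMap:
  "matching_family C F S x \<Longrightarrow> f \<in> S \<Longrightarrow> f \<in> Hom C X B \<Longrightarrow> g \<in> Hom C Y X \<Longrightarrow>
    PMap F g (x f) = x (f \<cdot>\<^bsub>C\<^esub> g)"
  unfolding matching_family_def Hom_def by auto

lemma in_pullback_sieve_iff:
  "h \<in> Hom C A B \<Longrightarrow> g \<in> Hom C Z A \<Longrightarrow> g \<in> pullback_sieve C h S \<longleftrightarrow> h \<cdot>\<^bsub>C\<^esub> g \<in> S"
  unfolding pullback_sieve_def Hom_def by auto

lemma pullback_sieve_Hom: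
  "h \<in> Hom C A B \<Longrightarrow> g \<in> pullback_sieve C h S \<Longrightarrow> g \<in> Hom C (Dom C g) A"
  unfolding pullback_sieve_def Hom_def by auto

lemma pullback_sieve_Comp:
  assumes "h \<in> Hom C A B" "k \<in> Hom C Z A"
  shows "pullback_sieve C k (pullback_sieve C h S) = pullback_sieve C (h \<cdot>\<^bsub>C\<^esub> k) S"
proof -
  note hk = Comp_Hom[OF assms(2,1)]
  have "g \<in> pullback_sieve C k (pullback_sieve C h S) \<longleftrightarrow> g \<in> pullback_sieve C (h \<cdot>\<^bsub>C\<^esub> k) S"
    if g: "g \<in> Hom C Y Z" for g Y
    using in_pullback_sieve_iff[OF assms(2) g] in_pullback_sieve_iff[OF assms(1) Comp_Hom[OF g assms(2)]]
      in_pullback_sieve_iff[OF hk g] Comp_assoc[OF g assms(2,1)] by simp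
  then show ?thesis using pullback_sieve_Hom[OF assms(2)] pullback_sieve_Hom[OF hk] by blast
qed

lemma pullback_sieve_of_member:
  assumes R: "is_sieve C B R" and r: "r \<in> R" "r \<in> Hom C A B"
  shows "pullback_sieve C r R = max_sieve C A"
  using assms unfolding pullback_sieve_def max_sieve_def is_sieve_def Hom_def by auto

lemma sheaf_for_max_sieve:
  assumes F: "presheaf C F" and B: "B \<in> Obj C"
  shows "sheaf_for C F B (max_sieve C B)"
proof (rule sheaf_forI)
  have mx: "f \<in> max_sieve C B \<longleftrightarrow> f \<in> Hom C (Dom C f) B" for f by (simp add: max_sieve_def Hom_def)
  have id: "Id C B \<in> Hom C B B" "Id C B \<in> max_sieve C B"
    using Id_Hom[OF B] by (auto simp: max_sieve_def Hom_def)
  show "\<exists>y\<in>PObj F B. \<forall>f\<in>max_sieve C B. PMap F f y = x f"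
    if x: "matching_family C F (max_sieve C B) x" for x
  proof (intro bexI ballI)
    show "x (Id C B) \<in> PObj F B" using matching_PObj[OF x id(2,1)] .
    fix f assume "f \<in> max_sieve C B"
    then have f: "f \<in> Hom C (Dom C f) B" using mx by blast
    show "PMap F f (x (Id C B)) = x f"
      using matching_PMap[OF x id(2,1) f] Id_Comp[OF f] by simp
  qed
  show "y = z" if "y \<in> PObj F B" "z \<in> PObj F B"
    "\<And>f. f \<in> max_sieve C B \<Longrightarrow> PMap F f y = PMap F f z" for y z
    using that(3)[OF id(2)] PMap_Id[OF F B] that(1,2) by simp
qed

lemma finest_topology_pullback:
  assumes "S \<in> finest_topology C F B" "h \<in> Hom C A B"
  shows "pullback_sieve C h S \<in> finest_topology C F A"
  using assms is_sieve_pullback[of B S h A] Comp_Hom pullback_sieve_Comp[OF assms(2)]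
  unfolding finest_topology_def by auto

lemma finest_topology_sheaf_for:
  assumes S: "S \<in> finest_topology C F B" and B: "B \<in> Obj C"
  shows "sheaf_for C F B S"
proof -
  have sv: "is_sieve C B S" using S unfolding finest_topology_def by blast
  have "f \<in> pullback_sieve C (Id C B) S \<longleftrightarrow> f \<in> S" for f
    using in_pullback_sieve_iff[OF Id_Hom[OF B], of f "Dom C f" S] Id_Comp[of f "Dom C f" B]
      pullback_sieve_Hom[OF Id_Hom[OF B], of f S] sieve_Hom[OF sv, of f] by auto
  then have "pullback_sieve C (Id C B) S = S" by blast
  then show ?thesis using S B Id_Hom[OF B] unfolding finest_topology_def by force
qed

text \<open>Two sections with equal restrictions amalgamate the same matching family.\<close>

lemma finest_topology_separated:
  assumes S: "S \<in> finest_topology C F B" and F: "presheaf C F" and B: "B \<in> Obj C"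
    and y: "y \<in> PObj F B" "z \<in> PObj F B" and eq: "\<And>f. f \<in> S \<Longrightarrow> PMap F f y = PMap F f z"
  shows "y = z"
proof -
  have sv: "is_sieve C B S" using S unfolding finest_topology_def by blast
  have "matching_family C F S (\<lambda>f. PMap F f z)"
    unfolding matching_family_def
  proof (intro conjI ballI impI)
    fix f assume "f \<in> S"
    note f = sieve_Hom[OF sv this]
    show "PMap F f z \<in> PObj F (Dom C f)" using PMap_PObj[OF F f y(2)] .
    fix g assume "g \<in> Arr C" "Cod C g = Dom C f"
    then have g: "g \<in> Hom C (Dom C g) (Dom C f)" by (simp add: Hom_def)
    show "PMap F g (PMap F f z) = PMap F (f \<cdot>\<^bsub>C\<^esub> g) z" using PMap_Comp[OF F g f y(2)] by simp
  qed
  then have "\<exists>!w. w \<in> PObj F B \<and> (\<forall>f\<in>S. PMap F f w = PMap F f z)"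
    using finest_topology_sheaf_for[OF S B] unfolding sheaf_for_def by blast
  then show ?thesis using y eq by blast
qed

text \<open>The local character of the sheaf condition, which gives the transitivity axiom. A family
  matching on \<open>R\<close> restricts to each pulled back sieve \<open>f\<^sup>* R\<close> with \<open>f \<in> S\<close> and amalgamates there to
  a section \<open>m f\<close>; uniqueness over the sieves \<open>(f g)\<^sup>* R\<close> makes \<open>m\<close> a matching family on \<open>S\<close>. Its
  amalgamation \<open>y\<close> has the right restriction along each \<open>r \<in> R\<close> because this can be tested on the
  pullback of \<open>S\<close> along \<open>r\<close>.\<close>

lemma sheaf_for_local:
  assumes F: "presheaf C F" and B: "B \<in> Obj C" and R: "is_sieve C B R"
    and S: "S \<in> finest_topology C F B"
    and loc: "\<And>f. f \<in> S \<Longrightarrow> pullback_sieve C f R \<in> finest_topology C F (Dom C f)"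
  shows "sheaf_for C F B R"
proof (rule sheaf_forI)
  have svS: "is_sieve C B S" using S unfolding finest_topology_def by blast
  have SH: "f \<in> Hom C (Dom C f) B" if "f \<in> S" for f using sieve_Hom[OF svS that] .
  have D: "Dom C f \<in> Obj C" if "f \<in> S" for f using Hom_Obj(1)[OF SH[OF that]] .
  show "y = z" if y: "y \<in> PObj F B" "z \<in> PObj F B" and
    eq: "\<And>r. r \<in> R \<Longrightarrow> PMap F r y = PMap F r z" for y z
  proof (rule finest_topology_separated[OF S F B y])
    fix f assume f: "f \<in> S"
    note fH = SH[OF f]
    show "PMap F f y = PMap F f z"
    proof (rule finest_topology_separated[OF loc[OF f] F D[OF f] PMap_PObj[OF F fH y(1)]
          PMap_PObj[OF F fH y(2)]])
      fix g assume g: "g \<in> pullback_sieve C f R"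
      note gH = pullback_sieve_Hom[OF fH g]
      have "f \<cdot>\<^bsub>C\<^esub> g \<in> R" using g in_pullback_sieve_iff[OF fH gH] by blast
      then show "PMap F g (PMap F f y) = PMap F g (PMap F f z)"
        using eq PMap_Comp[OF F gH fH] y by metis
    qed
  qed
  show "\<exists>y\<in>PObj F B. \<forall>r\<in>R. PMap F r y = x r" if x: "matching_family C F R x" for x
  proof -
    have "\<exists>y\<in>PObj F (Dom C f). \<forall>g\<in>pullback_sieve C f R. PMap F g y = x (f \<cdot>\<^bsub>C\<^esub> g)"
      if f: "f \<in> S" for f
    proof -
      note fH = SH[OF f]
      have "matching_family C F (pullback_sieve C f R) (\<lambda>g. x (f \<cdot>\<^bsub>C\<^esub> g))"
        unfolding matching_family_def
      proof (intro conjI ballI impI)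
        fix g assume g: "g \<in> pullback_sieve C f R"
        note gH = pullback_sieve_Hom[OF fH g]
        have fg: "f \<cdot>\<^bsub>C\<^esub> g \<in> R" using g in_pullback_sieve_iff[OF fH gH] by blast
        show "x (f \<cdot>\<^bsub>C\<^esub> g) \<in> PObj F (Dom C g)" using matching_PObj[OF x fg Comp_Hom[OF gH fH]] .
        fix k assume "k \<in> Arr C" "Cod C k = Dom C g"
        then have k: "k \<in> Hom C (Dom C k) (Dom C g)" by (simp add: Hom_def)
        show "PMap F k (x (f \<cdot>\<^bsub>C\<^esub> g)) = x (f \<cdot>\<^bsub>C\<^esub> (g \<cdot>\<^bsub>C\<^esub> k))"
          using matching_PMap[OF x fg Comp_Hom[OF gH fH] k] Comp_assoc[OF k gH fH] by simp
      qed
      then show ?thesis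
        using sheaf_for_amalgamation[OF finest_topology_sheaf_for[OF loc[OF f] D[OF f]]] by metis
    qed
    then obtain m where m: "\<And>f. f \<in> S \<Longrightarrow> m f \<in> PObj F (Dom C f)"
      "\<And>f g. f \<in> S \<Longrightarrow> g \<in> pullback_sieve C f R \<Longrightarrow> PMap F g (m f) = x (f \<cdot>\<^bsub>C\<^esub> g)" by metis
    have "matching_family C F S m"
      unfolding matching_family_def
    proof (intro conjI ballI impI)
      fix f assume f: "f \<in> S"
      note fH = SH[OF f]
      show "m f \<in> PObj F (Dom C f)" using m(1)[OF f] .
      fix g assume "g \<in> Arr C" "Cod C g = Dom C f"
      then have g: "g \<in> Hom C (Dom C g) (Dom C f)" by (simp add: Hom_def)
      note fgH = Comp_Hom[OF g fH]
      have fg: "f \<cdot>\<^bsub>C\<^esub> g \<in> S" using sieve_Comp[OF svS f fH g] .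
      have dom: "Dom C (f \<cdot>\<^bsub>C\<^esub> g) = Dom C g" using fgH by (simp add: Hom_def)
      show "PMap F g (m f) = m (f \<cdot>\<^bsub>C\<^esub> g)"
      proof (rule finest_topology_separated[OF loc[OF fg, unfolded dom] F Hom_Obj(1)[OF g]
            PMap_PObj[OF F g m(1)[OF f]] m(1)[OF fg, unfolded dom]])
        fix k assume k: "k \<in> pullback_sieve C (f \<cdot>\<^bsub>C\<^esub> g) R"
        note kH = pullback_sieve_Hom[OF fgH k]
        have "g \<cdot>\<^bsub>C\<^esub> k \<in> pullback_sieve C f R"
          using k in_pullback_sieve_iff[OF fgH kH] in_pullback_sieve_iff[OF fH Comp_Hom[OF kH g]]
            Comp_assoc[OF kH g fH] by simp
        then show "PMap F k (PMap F g (m f)) = PMap F k (m (f \<cdot>\<^bsub>C\<^esub> g))"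
          using m(2)[OF f] m(2)[OF fg k] PMap_Comp[OF F kH g m(1)[OF f]] Comp_assoc[OF kH g fH] by simp
      qed
    qed
    then obtain y where y: "y \<in> PObj F B" "\<And>f. f \<in> S \<Longrightarrow> PMap F f y = m f"
      using sheaf_for_amalgamation[OF finest_topology_sheaf_for[OF S B]] by blast
    have "PMap F r y = x r" if r: "r \<in> R" for r
    proof -
      note rH = sieve_Hom[OF R r]
      note DO = Hom_Obj(1)[OF rH]
      show ?thesis
      proof (rule finest_topology_separated[OF finest_topology_pullback[OF S rH] F DO
            PMap_PObj[OF F rH y(1)] matching_PObj[OF x r rH]])
        fix g assume g: "g \<in> pullback_sieve C r S"
        note gH = pullback_sieve_Hom[OF rH g]
        note GO = Hom_Obj(1)[OF gH]
        note rgH = Comp_Hom[OF gH rH]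
        have rgS: "r \<cdot>\<^bsub>C\<^esub> g \<in> S" using g in_pullback_sieve_iff[OF rH gH] by blast
        have rgR: "r \<cdot>\<^bsub>C\<^esub> g \<in> R" using sieve_Comp[OF R r rH gH] .
        have dom: "Dom C (r \<cdot>\<^bsub>C\<^esub> g) = Dom C g" using rgH by (simp add: Hom_def)
        \<comment> \<open>As \<open>r g\<close> already lies in \<open>R\<close>, the identity belongs to its pulled back sieve, so that
          \<open>m (r g)\<close> is the given section itself.\<close>
        have "Id C (Dom C g) \<in> pullback_sieve C (r \<cdot>\<^bsub>C\<^esub> g) R"
          using in_pullback_sieve_iff[OF rgH Id_Hom[OF GO]] Comp_Id[OF rgH] rgR by simp
        then have "m (r \<cdot>\<^bsub>C\<^esub> g) = x (r \<cdot>\<^bsub>C\<^esub> g)"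
          using m(2)[OF rgS] PMap_Id[OF F GO] m(1)[OF rgS] Comp_Id[OF rgH] dom by metis
        then show "PMap F g (PMap F r y) = PMap F g (x r)"
          using PMap_Comp[OF F gH rH y(1)] y(2)[OF rgS] matching_PMap[OF x r rH gH] by simp
      qed
    qed
    then show ?thesis using y(1) by blast
  qed
qed

lemma grothendieck_topology_finest:
  assumes F: "presheaf C F"
  shows "grothendieck_topology C (finest_topology C F)"
  unfolding grothendieck_topology_def
proof (intro conjI ballI allI impI)
  show "is_sieve C B S" if "S \<in> finest_topology C F B" for B S
    using that unfolding finest_topology_def by blast
  show "max_sieve C B \<in> finest_topology C F B" if "B \<in> Obj C" for B
  proof -
    have "pullback_sieve C h (max_sieve C B) = max_sieve C A" if h: "h \<in> Hom C A B" for A h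
    proof (rule pullback_sieve_of_member[OF is_sieve_max _ h])
      show "h \<in> max_sieve C B" using h by (simp add: max_sieve_def Hom_def)
    qed
    then show ?thesis
      unfolding finest_topology_def using is_sieve_max sheaf_for_max_sieve[OF F] by simp
  qed
  show "pullback_sieve C h S \<in> finest_topology C F A"
    if "S \<in> finest_topology C F B" "h \<in> Hom C A B" for A B S h
    using finest_topology_pullback[OF that] .
  fix B S R assume B: "B \<in> Obj C" and S: "S \<in> finest_topology C F B"
    and *: "is_sieve C B R \<and> (\<forall>f\<in>S. pullback_sieve C f R \<in> finest_topology C F (Dom C f))"
  have "sheaf_for C F A (pullback_sieve C h R)" if A: "A \<in> Obj C" and h: "h \<in> Hom C A B" for A h
  proof (rule sheaf_for_local[OF F A _ finest_topology_pullback[OF S h]])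
    show "is_sieve C A (pullback_sieve C h R)" using is_sieve_pullback * h by blast
    fix f assume f: "f \<in> pullback_sieve C h S"
    note fH = pullback_sieve_Hom[OF h f]
    have "h \<cdot>\<^bsub>C\<^esub> f \<in> S" using f in_pullback_sieve_iff[OF h fH] by blast
    moreover have "Dom C (h \<cdot>\<^bsub>C\<^esub> f) = Dom C f" using Comp_Hom[OF fH h] by (simp add: Hom_def)
    ultimately show "pullback_sieve C f (pullback_sieve C h R) \<in> finest_topology C F (Dom C f)"
      using * pullback_sieve_Comp[OF h fH] by metis
  qed
  then show "R \<in> finest_topology C F B" unfolding finest_topology_def using * by blast
qed

text \<open>The sheaf condition for a generated sieve in terms of its generators: a compatible family of
  sections over the generators extends to a well-defined matching family on the sieve.\<close>

lemma sheaf_for_generated_sieve: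
  assumes F: "presheaf C F" and f: "\<And>i. i \<in> I \<Longrightarrow> f i \<in> Hom C (X i) B"
    and sh: "sheaf_for C F B (generated_sieve C I f)"
    and x: "\<And>i. i \<in> I \<Longrightarrow> x i \<in> PObj F (X i)"
    and compat: "\<And>i j Z u v. i \<in> I \<Longrightarrow> j \<in> I \<Longrightarrow> u \<in> Hom C Z (X i) \<Longrightarrow> v \<in> Hom C Z (X j) \<Longrightarrow>
      f i \<cdot>\<^bsub>C\<^esub> u = f j \<cdot>\<^bsub>C\<^esub> v \<Longrightarrow> PMap F u (x i) = PMap F v (x j)"
  shows "\<exists>!y. y \<in> PObj F B \<and> (\<forall>i\<in>I. PMap F (f i) y = x i)"
proof -
  let ?S = "generated_sieve C I f"
  have S: "h \<in> ?S \<longleftrightarrow> (\<exists>i\<in>I. \<exists>Z. \<exists>g\<in>Hom C Z (X i). h = f i \<cdot>\<^bsub>C\<^esub> g)" for h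
    unfolding generated_sieve_def using f by (fastforce simp: Hom_def)
  have "\<exists>m. \<forall>i\<in>I. \<forall>Z. \<forall>g\<in>Hom C Z (X i). m (f i \<cdot>\<^bsub>C\<^esub> g) = PMap F g (x i)"
  proof (intro exI ballI allI)
    let ?m = "\<lambda>h. THE v. \<exists>i\<in>I. \<exists>Z. \<exists>g\<in>Hom C Z (X i). h = f i \<cdot>\<^bsub>C\<^esub> g \<and> v = PMap F g (x i)"
    fix i Z g assume i: "i \<in> I" and g: "g \<in> Hom C Z (X i)"
    show "?m (f i \<cdot>\<^bsub>C\<^esub> g) = PMap F g (x i)"
    proof (rule the_equality)
      fix v assume "\<exists>j\<in>I. \<exists>Z. \<exists>h\<in>Hom C Z (X j). f i \<cdot>\<^bsub>C\<^esub> g = f j \<cdot>\<^bsub>C\<^esub> h \<and> v = PMap F h (x j)"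
      then obtain j Z' h where j: "j \<in> I" and h: "h \<in> Hom C Z' (X j)"
        and eq: "f i \<cdot>\<^bsub>C\<^esub> g = f j \<cdot>\<^bsub>C\<^esub> h" and v: "v = PMap F h (x j)" by blast
      have "Z' = Z" using Comp_Hom[OF g f[OF i]] Comp_Hom[OF h f[OF j]] eq by (simp add: Hom_def)
      then show "v = PMap F g (x i)" using compat[OF i j g _ eq] h v by simp
    qed (use i g in blast)
  qed
  then obtain m where m: "\<And>i Z g. i \<in> I \<Longrightarrow> g \<in> Hom C Z (X i) \<Longrightarrow> m (f i \<cdot>\<^bsub>C\<^esub> g) = PMap F g (x i)"
    by blast
  have mm: "matching_family C F ?S m"
    unfolding matching_family_def
  proof (intro conjI ballI impI)
    fix h assume "h \<in> ?S"
    then obtain i Z g where i: "i \<in> I" and g: "g \<in> Hom C Z (X i)" and h: "h = f i \<cdot>\<^bsub>C\<^esub> g"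
      using S by blast
    have dom: "Dom C h = Z" using Comp_Hom[OF g f[OF i]] h by (simp add: Hom_def)
    show "m h \<in> PObj F (Dom C h)" using PMap_PObj[OF F g x[OF i]] m[OF i g] h dom by simp
    fix k assume "k \<in> Arr C" "Cod C k = Dom C h"
    then have k: "k \<in> Hom C (Dom C k) Z" by (simp add: Hom_def dom)
    show "PMap F k (m h) = m (h \<cdot>\<^bsub>C\<^esub> k)"
      using m[OF i g] m[OF i Comp_Hom[OF k g]] Comp_assoc[OF k g f[OF i]] h
        PMap_Comp[OF F k g x[OF i]] by simp
  qed
  have "(\<forall>h\<in>?S. PMap F h y = m h) \<longleftrightarrow> (\<forall>i\<in>I. PMap F (f i) y = x i)" if y: "y \<in> PObj F B" for y
  proof
    assume *: "\<forall>h\<in>?S. PMap F h y = m h"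
    show "\<forall>i\<in>I. PMap F (f i) y = x i"
    proof
      fix i assume i: "i \<in> I"
      have XO: "X i \<in> Obj C" using Hom_Obj(1)[OF f[OF i]] .
      have "f i \<in> ?S" "m (f i) = x i"
        using S i Id_Hom[OF XO] Comp_Id[OF f[OF i]] m[OF i Id_Hom[OF XO]] PMap_Id[OF F XO x[OF i]]
        by (metis, metis)
      then show "PMap F (f i) y = x i" using * by simp
    qed
  next
    assume *: "\<forall>i\<in>I. PMap F (f i) y = x i"
    show "\<forall>h\<in>?S. PMap F h y = m h"
    proof
      fix h assume "h \<in> ?S"
      then obtain i Z g where i: "i \<in> I" and g: "g \<in> Hom C Z (X i)" and h: "h = f i \<cdot>\<^bsub>C\<^esub> g"
        using S by blast
      show "PMap F h y = m h" using PMap_Comp[OF F g f[OF i] y] m[OF i g] h * i by simp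
    qed
  qed
  then have eq: "(y \<in> PObj F B \<and> (\<forall>h\<in>?S. PMap F h y = m h)) \<longleftrightarrow>
      (y \<in> PObj F B \<and> (\<forall>i\<in>I. PMap F (f i) y = x i))" for y by blast
  have "\<exists>!y. y \<in> PObj F B \<and> (\<forall>h\<in>?S. PMap F h y = m h)"
    using sh mm unfolding sheaf_for_def by blast
  then show ?thesis unfolding eq .
qed


section \<open>Effective epimorphic families and coproducts\<close>

lemma effective_epi_Hom: "effective_epi C Y X f \<Longrightarrow> f \<in> Hom C Y X"
  unfolding effective_epi_def by blast

lemma effective_epi_factor:
  assumes "effective_epi C Y X f" "W \<in> Obj C" "e \<in> Hom C Y W"
    and compat: "\<And>Z u v. u \<in> Hom C Z Y \<Longrightarrow> v \<in> Hom C Z Y \<Longrightarrow>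
      f \<cdot>\<^bsub>C\<^esub> u = f \<cdot>\<^bsub>C\<^esub> v \<Longrightarrow> e \<cdot>\<^bsub>C\<^esub> u = e \<cdot>\<^bsub>C\<^esub> v"
  shows "\<exists>!d. d \<in> Hom C X W \<and> d \<cdot>\<^bsub>C\<^esub> f = e"
  by (rule assms(1)[unfolded effective_epi_def, THEN conjunct2, rule_format, OF assms(2,3)])
    (rule compat; assumption)

lemma effective_epi_family_factor:
  assumes "effective_epi_family C I X B f" "W \<in> Obj C"
    and e: "\<And>i. i \<in> I \<Longrightarrow> e i \<in> Hom C (X i) W"
    and compat: "\<And>i j Z u v. i \<in> I \<Longrightarrow> j \<in> I \<Longrightarrow> u \<in> Hom C Z (X i) \<Longrightarrow> v \<in> Hom C Z (X j) \<Longrightarrow>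
      f i \<cdot>\<^bsub>C\<^esub> u = f j \<cdot>\<^bsub>C\<^esub> v \<Longrightarrow> e i \<cdot>\<^bsub>C\<^esub> u = e j \<cdot>\<^bsub>C\<^esub> v"
  shows "\<exists>!d. d \<in> Hom C B W \<and> (\<forall>i\<in>I. d \<cdot>\<^bsub>C\<^esub> f i = e i)"
  by (rule assms(1)[unfolded effective_epi_family_def, THEN conjunct2, THEN conjunct2, rule_format,
        OF assms(2)])
    ((rule e, assumption), (rule compat; assumption))

lemma effective_epi_single_family:
  assumes "effective_epi C X B \<pi>"
  shows "effective_epi_family C {0 :: nat} (\<lambda>_. X) B (\<lambda>_. \<pi>)"
  unfolding effective_epi_family_def
proof (intro conjI allI impI ballI)
  have \<pi>: "\<pi> \<in> Hom C X B" using effective_epi_Hom[OF assms] .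
  show "B \<in> Obj C" using Hom_Obj(2)[OF \<pi>] .
  show "\<pi> \<in> Hom C X B" by (rule \<pi>)
  fix W and e :: "nat \<Rightarrow> 'a" assume W: "W \<in> Obj C" and e: "\<forall>i\<in>{0}. e i \<in> Hom C X W"
    and c: "\<forall>i\<in>{0}. \<forall>j\<in>{0}. \<forall>Z\<in>Obj C. \<forall>u\<in>Hom C Z X. \<forall>v\<in>Hom C Z X.
      \<pi> \<cdot>\<^bsub>C\<^esub> u = \<pi> \<cdot>\<^bsub>C\<^esub> v \<longrightarrow> e i \<cdot>\<^bsub>C\<^esub> u = e j \<cdot>\<^bsub>C\<^esub> v"
  have "\<exists>!d. d \<in> Hom C B W \<and> d \<cdot>\<^bsub>C\<^esub> \<pi> = e 0"
  proof (rule effective_epi_factor[OF assms W])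
    show "e 0 \<in> Hom C X W" using e by blast
    show "e 0 \<cdot>\<^bsub>C\<^esub> u = e 0 \<cdot>\<^bsub>C\<^esub> v"
      if "u \<in> Hom C Z X" "v \<in> Hom C Z X" "\<pi> \<cdot>\<^bsub>C\<^esub> u = \<pi> \<cdot>\<^bsub>C\<^esub> v" for Z u v
      using c that Hom_Obj(1)[OF that(1)] by blast
  qed
  then show "\<exists>!d. d \<in> Hom C B W \<and> (\<forall>i\<in>{0}. d \<cdot>\<^bsub>C\<^esub> \<pi> = e i)" by simp
qed

lemma coproduct_effective_epi_family:
  assumes "is_coproduct C I T Q \<iota>"
  shows "effective_epi_family C I T Q \<iota>"
  unfolding effective_epi_family_def
proof (intro conjI ballI allI impI)
  show "Q \<in> Obj C" using assms unfolding is_coproduct_def by blast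
  show "\<iota> i \<in> Hom C (T i) Q" if "i \<in> I" for i using coproduct_Hom[OF assms that] .
  show "\<exists>!d. d \<in> Hom C Q W \<and> (\<forall>i\<in>I. d \<cdot>\<^bsub>C\<^esub> \<iota> i = e i)"
    if "W \<in> Obj C" "\<forall>i\<in>I. e i \<in> Hom C (T i) W" for W e
    using assms that unfolding is_coproduct_def by blast
qed

text \<open>A map out of \<open>Q\<close> that is compatible with \<open>\<pi>\<close> restricts
  to a family compatible with \<open>f\<close>, since equal composites with \<open>f\<close> are equal composites with \<open>\<pi>\<close>.\<close>

lemma effective_epi_of_family:
  assumes f: "effective_epi_family C I X B f" and Q: "is_coproduct C I X Q \<iota>"
    and \<pi>: "\<pi> \<in> Hom C Q B" and \<pi>\<iota>: "\<And>i. i \<in> I \<Longrightarrow> \<pi> \<cdot>\<^bsub>C\<^esub> \<iota> i = f i"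
  shows "effective_epi C Q B \<pi>"
  unfolding effective_epi_def
proof (intro conjI ballI impI)
  note \<iota> = coproduct_Hom[OF Q]
  fix W e assume W: "W \<in> Obj C" and e: "e \<in> Hom C Q W"
    and c: "\<forall>Z\<in>Obj C. \<forall>u\<in>Hom C Z Q. \<forall>v\<in>Hom C Z Q.
      \<pi> \<cdot>\<^bsub>C\<^esub> u = \<pi> \<cdot>\<^bsub>C\<^esub> v \<longrightarrow> e \<cdot>\<^bsub>C\<^esub> u = e \<cdot>\<^bsub>C\<^esub> v"
  have compat: "(e \<cdot>\<^bsub>C\<^esub> \<iota> i) \<cdot>\<^bsub>C\<^esub> u = (e \<cdot>\<^bsub>C\<^esub> \<iota> j) \<cdot>\<^bsub>C\<^esub> v"
    if "i \<in> I" "j \<in> I" and u: "u \<in> Hom C Z (X i)" and v: "v \<in> Hom C Z (X j)"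
      and eq: "f i \<cdot>\<^bsub>C\<^esub> u = f j \<cdot>\<^bsub>C\<^esub> v" for i j Z u v
  proof -
    note i = \<iota>[OF that(1)] and j = \<iota>[OF that(2)]
    have "\<pi> \<cdot>\<^bsub>C\<^esub> (\<iota> i \<cdot>\<^bsub>C\<^esub> u) = \<pi> \<cdot>\<^bsub>C\<^esub> (\<iota> j \<cdot>\<^bsub>C\<^esub> v)"
      using Comp_assoc[OF u i \<pi>] Comp_assoc[OF v j \<pi>] \<pi>\<iota>[OF that(1)] \<pi>\<iota>[OF that(2)] eq by simp
    then have "e \<cdot>\<^bsub>C\<^esub> (\<iota> i \<cdot>\<^bsub>C\<^esub> u) = e \<cdot>\<^bsub>C\<^esub> (\<iota> j \<cdot>\<^bsub>C\<^esub> v)"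
      using c Hom_Obj(1)[OF u] Comp_Hom[OF u i] Comp_Hom[OF v j] by blast
    then show ?thesis using Comp_assoc[OF u i e] Comp_assoc[OF v j e] by simp
  qed
  have "\<exists>!d. d \<in> Hom C B W \<and> (\<forall>i\<in>I. d \<cdot>\<^bsub>C\<^esub> f i = e \<cdot>\<^bsub>C\<^esub> \<iota> i)"
    by (rule effective_epi_family_factor[OF f W Comp_Hom[OF \<iota> e]]) (assumption, rule compat)
  moreover have "(d \<in> Hom C B W \<and> (\<forall>i\<in>I. d \<cdot>\<^bsub>C\<^esub> f i = e \<cdot>\<^bsub>C\<^esub> \<iota> i)) \<longleftrightarrow>
      (d \<in> Hom C B W \<and> d \<cdot>\<^bsub>C\<^esub> \<pi> = e)" for d
  proof (rule conj_cong[OF refl])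
    assume d: "d \<in> Hom C B W"
    have "d \<cdot>\<^bsub>C\<^esub> f i = (d \<cdot>\<^bsub>C\<^esub> \<pi>) \<cdot>\<^bsub>C\<^esub> \<iota> i" if "i \<in> I" for i
      using Comp_assoc[OF \<iota>[OF that] \<pi> d] \<pi>\<iota>[OF that] by simp
    then show "(\<forall>i\<in>I. d \<cdot>\<^bsub>C\<^esub> f i = e \<cdot>\<^bsub>C\<^esub> \<iota> i) \<longleftrightarrow> d \<cdot>\<^bsub>C\<^esub> \<pi> = e"
      using coproduct_jointly_epi[OF Q Comp_Hom[OF \<pi> d] e] by auto
  qed
  ultimately show "\<exists>!d. d \<in> Hom C B W \<and> d \<cdot>\<^bsub>C\<^esub> \<pi> = e" by simp
qed (rule \<pi>)


section \<open>Coherent sheaves satisfy descent and preserve products\<close>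

lemma bij_betw_of_unique_preimages:
  assumes "\<And>a. a \<in> A \<Longrightarrow> f a \<in> D" "\<And>d. d \<in> D \<Longrightarrow> \<exists>!a. a \<in> A \<and> f a = d"
  shows "bij_betw f A D"
proof (rule bij_betw_imageI)
  show "inj_on f A" unfolding inj_on_def using assms by metis
  show "f ` A = D" using assms by (metis image_eqI image_subsetI subsetI subset_antisym)
qed

lemma coherent_sheaf_amalgamation:
  assumes F: "presheaf C F" and sheaf: "is_sheaf C (coherent_topology C) F"
    and I: "finite (I :: nat set)" and f: "effective_epi_family C I X B f"
    and x: "\<And>i. i \<in> I \<Longrightarrow> x i \<in> PObj F (X i)"
    and compat: "\<And>i j Z u v. i \<in> I \<Longrightarrow> j \<in> I \<Longrightarrow> u \<in> Hom C Z (X i) \<Longrightarrow> v \<in> Hom C Z (X j) \<Longrightarrow>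
      f i \<cdot>\<^bsub>C\<^esub> u = f j \<cdot>\<^bsub>C\<^esub> v \<Longrightarrow> PMap F u (x i) = PMap F v (x j)"
  shows "\<exists>!y. y \<in> PObj F B \<and> (\<forall>i\<in>I. PMap F (f i) y = x i)"
proof (rule sheaf_for_generated_sieve[OF F])
  have "generated_sieve C I f \<in> coherent_topology C B"
    by (rule coherent_topology_covers[unfolded covers_finite_effective_epi_families_def, rule_format])
      (rule conjI[OF I f])
  moreover have "B \<in> Obj C" using f unfolding effective_epi_family_def by blast
  ultimately show "sheaf_for C F B (generated_sieve C I f)"
    using sheaf unfolding is_sheaf_def sheaf_for_def[symmetric] by blast
  show "f i \<in> Hom C (X i) B" if "i \<in> I" for i
    using f that unfolding effective_epi_family_def by blast
qed (rule x, assumption, rule compat)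

lemma coherent_sheaf_equalizer:
  assumes F: "presheaf C F" and sheaf: "is_sheaf C (coherent_topology C) F"
    and epi: "effective_epi C X B \<pi>" and pb: "is_pullback C p q \<pi> \<pi>"
  shows "set_equalizer (PObj F B) (PMap F \<pi>) (PObj F X) (PMap F p) (PMap F q)"
  unfolding set_equalizer_def
proof (rule bij_betw_of_unique_preimages)
  have \<pi>: "\<pi> \<in> Hom C X B" using effective_epi_Hom[OF epi] .
  note legs = pullback_legs[OF pb \<pi> \<pi>]
  show "PMap F \<pi> y \<in> {x \<in> PObj F X. PMap F p x = PMap F q x}" if y: "y \<in> PObj F B" for y
    using PMap_PObj[OF F \<pi> y] PMap_Comp[OF F legs(1) \<pi> y] PMap_Comp[OF F legs(2) \<pi> y] legs(3) by simp
  fix x assume "x \<in> {x \<in> PObj F X. PMap F p x = PMap F q x}"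
  then have x: "x \<in> PObj F X" "PMap F p x = PMap F q x" by auto
  have "PMap F u x = PMap F v x"
    if uv: "u \<in> Hom C Z X" "v \<in> Hom C Z X" "\<pi> \<cdot>\<^bsub>C\<^esub> u = \<pi> \<cdot>\<^bsub>C\<^esub> v" for Z u v
  proof -
    obtain w where w: "w \<in> Hom C Z (Dom C p)" "p \<cdot>\<^bsub>C\<^esub> w = u" "q \<cdot>\<^bsub>C\<^esub> w = v"
      using pullback_factor[OF pb \<pi> \<pi> uv] .
    then show ?thesis
      using PMap_Comp[OF F w(1) legs(1) x(1)] PMap_Comp[OF F w(1) legs(2) x(1)] x(2) by simp
  qed
  then have "\<exists>!y. y \<in> PObj F B \<and> (\<forall>i\<in>{0 :: nat}. PMap F \<pi> y = x)"
    by (intro coherent_sheaf_amalgamation[OF F sheaf _ effective_epi_single_family[OF epi],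
        where x = "\<lambda>_. x"] finite.intros x(1)) assumption
  then show "\<exists>!y. y \<in> PObj F B \<and> PMap F \<pi> y = x" by simp
qed

text \<open>The empty family is effective epimorphic over an initial object, and gluing along it says
  that there is exactly one section.\<close>

lemma coherent_sheaf_initial:
  assumes F: "presheaf C F" and sheaf: "is_sheaf C (coherent_topology C) F"
    and Z: "initial C Z" and "y \<in> PObj F Z" "z \<in> PObj F Z"
  shows "y = z"
proof -
  have "effective_epi_family C ({} :: nat set) undefined Z undefined"
    by (rule coproduct_effective_epi_family) (simp only: empty_coproduct_iff_initial Z)
  from coherent_sheaf_amalgamation[OF F sheaf _ this] have "\<exists>!y. y \<in> PObj F Z" by simp
  then show ?thesis using assms by blast
qed

lemma coherent_sheaf_preserves_finite_products:
  assumes F: "presheaf C F" and sheaf: "is_sheaf C (coherent_topology C) F"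
    and ext: "finitary_extensive C"
  shows "preserves_finite_products C F"
  unfolding preserves_finite_products_def
proof (intro allI impI)
  fix I :: "nat set" and T Q \<iota>
  assume "finite I \<and> (\<forall>i\<in>I. T i \<in> Obj C) \<and> is_coproduct C I T Q \<iota>"
  then have I: "finite I" and Q: "is_coproduct C I T Q \<iota>" by auto
  show "bij_betw (\<lambda>x. \<lambda>i\<in>I. PMap F (\<iota> i) x) (PObj F Q) (\<Pi>\<^sub>E i\<in>I. PObj F (T i))"
  proof (rule bij_betw_of_unique_preimages)
    show "(\<lambda>i\<in>I. PMap F (\<iota> i) y) \<in> (\<Pi>\<^sub>E i\<in>I. PObj F (T i))" if "y \<in> PObj F Q" for y
      using PMap_PObj[OF F coproduct_Hom[OF Q] that] by auto
    fix x assume x: "x \<in> (\<Pi>\<^sub>E i\<in>I. PObj F (T i))"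
    have xi: "x i \<in> PObj F (T i)" if "i \<in> I" for i using x that by auto
    have "\<exists>!y. y \<in> PObj F Q \<and> (\<forall>i\<in>I. PMap F (\<iota> i) y = x i)"
    proof (rule coherent_sheaf_amalgamation[OF F sheaf I coproduct_effective_epi_family[OF Q] xi])
      fix i j Z u v assume ij: "i \<in> I" "j \<in> I" and uv: "u \<in> Hom C Z (T i)" "v \<in> Hom C Z (T j)"
        and eq: "\<iota> i \<cdot>\<^bsub>C\<^esub> u = \<iota> j \<cdot>\<^bsub>C\<^esub> v"
      show "PMap F u (x i) = PMap F v (x j)"
        using coprojections_compatible[OF ext I Q ij uv eq]
          coherent_sheaf_initial[OF F sheaf _ PMap_PObj[OF F uv(1) xi[OF ij(1)]]
            PMap_PObj[OF F uv(2) xi[OF ij(2)]]] by blast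
    qed
    moreover have "(\<lambda>i\<in>I. PMap F (\<iota> i) y) = x \<longleftrightarrow> (\<forall>i\<in>I. PMap F (\<iota> i) y = x i)" for y
      using x by (auto simp: fun_eq_iff PiE_def extensional_def)
    ultimately show "\<exists>!y. y \<in> PObj F Q \<and> (\<lambda>i\<in>I. PMap F (\<iota> i) y) = x" by simp
  qed
qed

end


section \<open>Presheaves with descent that preserve products are coherent sheaves\<close>

text \<open>Every finite effective epimorphic family has the form \<open>\<pi> \<iota>\<^sub>i\<close>. Asking a sieve to contain
  such a family, rather than to be generated by it, makes the condition stable under pullback.\<close>

definition coproduct_cover :: "('o, 'a) cat \<Rightarrow> 'o \<Rightarrow> 'a set \<Rightarrow> bool" where
  "coproduct_cover C B S \<longleftrightarrow>
    (\<exists>Q \<pi> (I :: nat set) T \<iota>. effective_epi C Q B \<pi> \<and> finite I \<and> is_coproduct C I T Q \<iota> \<and>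
      (\<forall>i\<in>I. \<pi> \<cdot>\<^bsub>C\<^esub> \<iota> i \<in> S))"

locale descent_presheaf = category C for C :: "('o, 'a) cat" +
  fixes F :: "('o, 'a, 'v) psh"
  assumes preregular: "preregular C"
    and extensive: "finitary_extensive C"
    and kernel_pair: "effective_epi C X B \<pi> \<Longrightarrow> \<exists>p q. is_pullback C p q \<pi> \<pi>"
    and presheaf: "presheaf C F"
    and equalizer: "effective_epi C X B \<pi> \<Longrightarrow> is_pullback C p q \<pi> \<pi> \<Longrightarrow>
      set_equalizer (PObj F B) (PMap F \<pi>) (PObj F X) (PMap F p) (PMap F q)"
    and products: "preserves_finite_products C F"
begin

lemma effective_epi_separated:
  assumes "effective_epi C X B \<pi>" "y \<in> PObj F B" "z \<in> PObj F B" "PMap F \<pi> y = PMap F \<pi> z"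
  shows "y = z"
proof -
  obtain p q where "is_pullback C p q \<pi> \<pi>" using kernel_pair[OF assms(1)] by blast
  from equalizer[OF assms(1) this] have "inj_on (PMap F \<pi>) (PObj F B)"
    unfolding set_equalizer_def bij_betw_def by blast
  then show ?thesis using assms(2-4) unfolding inj_on_def by blast
qed

lemma effective_epi_descent:
  assumes epi: "effective_epi C X B \<pi>" and x: "x \<in> PObj F X"
    and compat: "\<And>Z u v. u \<in> Hom C Z X \<Longrightarrow> v \<in> Hom C Z X \<Longrightarrow> \<pi> \<cdot>\<^bsub>C\<^esub> u = \<pi> \<cdot>\<^bsub>C\<^esub> v \<Longrightarrow>
      PMap F u x = PMap F v x"
  obtains y where "y \<in> PObj F B" "PMap F \<pi> y = x"
proof -
  have \<pi>: "\<pi> \<in> Hom C X B" using effective_epi_Hom[OF epi] .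
  obtain p q where pb: "is_pullback C p q \<pi> \<pi>" using kernel_pair[OF epi] by blast
  have "PMap F p x = PMap F q x" using compat pullback_legs[OF pb \<pi> \<pi>] by blast
  moreover have "PMap F \<pi> ` PObj F B = {x \<in> PObj F X. PMap F p x = PMap F q x}"
    using equalizer[OF epi pb] unfolding set_equalizer_def bij_betw_def by blast
  ultimately have "x \<in> PMap F \<pi> ` PObj F B" using x by simp
  then show ?thesis using that by blast
qed

lemma coproduct_bij:
  assumes "finite (I :: nat set)" "is_coproduct C I T Q \<iota>"
  shows "bij_betw (\<lambda>x. \<lambda>i\<in>I. PMap F (\<iota> i) x) (PObj F Q) (\<Pi>\<^sub>E i\<in>I. PObj F (T i))"
proof -
  have "finite I \<and> (\<forall>i\<in>I. T i \<in> Obj C) \<and> is_coproduct C I T Q \<iota>"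
    using assms coproduct_Obj[OF assms(2)] by blast
  then show ?thesis
    by (rule products[unfolded preserves_finite_products_def, THEN spec, THEN spec, THEN spec,
        THEN spec, THEN mp])
qed

lemma coproduct_separated:
  assumes "finite (I :: nat set)" "is_coproduct C I T Q \<iota>" "y \<in> PObj F Q" "z \<in> PObj F Q"
    and "\<And>i. i \<in> I \<Longrightarrow> PMap F (\<iota> i) y = PMap F (\<iota> i) z"
  shows "y = z"
proof -
  have "(\<lambda>i\<in>I. PMap F (\<iota> i) y) = (\<lambda>i\<in>I. PMap F (\<iota> i) z)" by (rule restrict_ext) (rule assms(5))
  then show ?thesis
    by (rule inj_onD[OF bij_betw_imp_inj_on[OF coproduct_bij[OF assms(1,2)]] _ assms(3,4)])
qed

lemma coproduct_glue:
  assumes "finite (I :: nat set)" "is_coproduct C I T Q \<iota>" "\<And>i. i \<in> I \<Longrightarrow> x i \<in> PObj F (T i)"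
  obtains y where "y \<in> PObj F Q" "\<And>i. i \<in> I \<Longrightarrow> PMap F (\<iota> i) y = x i"
proof -
  have "restrict x I \<in> (\<lambda>x. \<lambda>i\<in>I. PMap F (\<iota> i) x) ` PObj F Q"
    unfolding bij_betw_imp_surj_on[OF coproduct_bij[OF assms(1,2)]] restrict_PiE_iff
    using assms(3) by blast
  then obtain y where y: "y \<in> PObj F Q" "restrict x I = (\<lambda>i\<in>I. PMap F (\<iota> i) y)" by blast
  have "PMap F (\<iota> i) y = x i" if "i \<in> I" for i using fun_cong[OF y(2), of i] that by simp
  then show ?thesis using that y(1) by blast
qed

lemma cover_separated:
  assumes epi: "effective_epi C W A \<rho>" and I: "finite (I :: nat set)" and w: "is_coproduct C I U W w"
    and y: "y \<in> PObj F A" "z \<in> PObj F A"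
    and eq: "\<And>i. i \<in> I \<Longrightarrow> PMap F (\<rho> \<cdot>\<^bsub>C\<^esub> w i) y = PMap F (\<rho> \<cdot>\<^bsub>C\<^esub> w i) z"
  shows "y = z"
proof -
  have \<rho>: "\<rho> \<in> Hom C W A" using effective_epi_Hom[OF epi] .
  note P = PMap_PObj[OF presheaf \<rho>]
  have "PMap F \<rho> y = PMap F \<rho> z"
  proof (rule coproduct_separated[OF I w P[OF y(1)] P[OF y(2)]])
    fix i assume "i \<in> I"
    then show "PMap F (w i) (PMap F \<rho> y) = PMap F (w i) (PMap F \<rho> z)"
      using eq PMap_Comp[OF presheaf coproduct_Hom[OF w] \<rho>] y by metis
  qed
  then show ?thesis using effective_epi_separated[OF epi y] by blast
qed

text \<open>Preregularity turns \<open>h\<close> into a map \<open>k : W \<rightarrow> Q\<close> after the effective epimorphism \<open>\<rho>\<close>; then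
  pulling the summands of \<open>Q\<close> back along \<open>k\<close> splits \<open>W\<close>.\<close>

lemma cover_lift:
  assumes epi: "effective_epi C Q B \<pi>" and I: "finite (I :: nat set)" and Q: "is_coproduct C I T Q \<iota>"
    and h: "h \<in> Hom C A B"
  obtains W \<rho> U w t where "effective_epi C W A \<rho>" "is_coproduct C I U W w"
    "\<And>i. i \<in> I \<Longrightarrow> t i \<in> Hom C (U i) (T i)"
    "\<And>i. i \<in> I \<Longrightarrow> h \<cdot>\<^bsub>C\<^esub> (\<rho> \<cdot>\<^bsub>C\<^esub> w i) = (\<pi> \<cdot>\<^bsub>C\<^esub> \<iota> i) \<cdot>\<^bsub>C\<^esub> t i"
proof -
  have \<pi>: "\<pi> \<in> Hom C Q B" using effective_epi_Hom[OF epi] .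
  obtain W \<rho> k where \<rho>: "effective_epi C W A \<rho>" and k: "k \<in> Hom C W Q"
    and sq: "\<pi> \<cdot>\<^bsub>C\<^esub> k = h \<cdot>\<^bsub>C\<^esub> \<rho>"
    using preregular[unfolded preregular_def, rule_format, OF conjI[OF epi h]] by blast
  note \<rho>H = effective_epi_Hom[OF \<rho>]
  obtain U w t where w: "is_coproduct C I U W w"
    and t: "\<And>i. i \<in> I \<Longrightarrow> t i \<in> Hom C (U i) (T i)" "\<And>i. i \<in> I \<Longrightarrow> \<iota> i \<cdot>\<^bsub>C\<^esub> t i = k \<cdot>\<^bsub>C\<^esub> w i"
    using coproduct_pullback[OF extensive I Q k] by blast
  have "h \<cdot>\<^bsub>C\<^esub> (\<rho> \<cdot>\<^bsub>C\<^esub> w i) = (\<pi> \<cdot>\<^bsub>C\<^esub> \<iota> i) \<cdot>\<^bsub>C\<^esub> t i" if i: "i \<in> I" for i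
  proof -
    note wH = coproduct_Hom[OF w i] and \<iota>H = coproduct_Hom[OF Q i]
    have "h \<cdot>\<^bsub>C\<^esub> (\<rho> \<cdot>\<^bsub>C\<^esub> w i) = \<pi> \<cdot>\<^bsub>C\<^esub> (k \<cdot>\<^bsub>C\<^esub> w i)"
      using Comp_assoc[OF wH \<rho>H h] Comp_assoc[OF wH k \<pi>] sq by simp
    then show ?thesis using t(2)[OF i] Comp_assoc[OF t(1)[OF i] \<iota>H \<pi>] by simp
  qed
  then show ?thesis using that[OF \<rho> w t(1)] by blast
qed

lemma coproduct_cover_pullback:
  assumes S: "is_sieve C B S" "coproduct_cover C B S" and h: "h \<in> Hom C A B"
  shows "coproduct_cover C A (pullback_sieve C h S)"
proof -
  obtain Q \<pi> T \<iota> and I :: "nat set" where epi: "effective_epi C Q B \<pi>" and I: "finite I"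
    and Q: "is_coproduct C I T Q \<iota>" and mem: "\<And>i. i \<in> I \<Longrightarrow> \<pi> \<cdot>\<^bsub>C\<^esub> \<iota> i \<in> S"
    using S(2) unfolding coproduct_cover_def by blast
  obtain W \<rho> U w t where \<rho>: "effective_epi C W A \<rho>" and w: "is_coproduct C I U W w"
    and t: "\<And>i. i \<in> I \<Longrightarrow> t i \<in> Hom C (U i) (T i)"
      "\<And>i. i \<in> I \<Longrightarrow> h \<cdot>\<^bsub>C\<^esub> (\<rho> \<cdot>\<^bsub>C\<^esub> w i) = (\<pi> \<cdot>\<^bsub>C\<^esub> \<iota> i) \<cdot>\<^bsub>C\<^esub> t i"
    using cover_lift[OF epi I Q h] by blast
  have "\<rho> \<cdot>\<^bsub>C\<^esub> w i \<in> pullback_sieve C h S" if i: "i \<in> I" for i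
    using in_pullback_sieve_iff[OF h Comp_Hom[OF coproduct_Hom[OF w i] effective_epi_Hom[OF \<rho>]]]
      sieve_Comp[OF S(1) mem[OF i] Comp_Hom[OF coproduct_Hom[OF Q i] effective_epi_Hom[OF epi]]
        t(1)[OF i]] t(2)[OF i] by simp
  then show ?thesis unfolding coproduct_cover_def using \<rho> I w by blast
qed

lemma coproduct_cover_separated:
  assumes S: "coproduct_cover C A S" and y: "y \<in> PObj F A" "z \<in> PObj F A"
    and eq: "\<And>f. f \<in> S \<Longrightarrow> PMap F f y = PMap F f z"
  shows "y = z"
proof -
  obtain W \<rho> U w and I :: "nat set" where "effective_epi C W A \<rho>" "finite I"
    "is_coproduct C I U W w" and mem: "\<And>i. i \<in> I \<Longrightarrow> \<rho> \<cdot>\<^bsub>C\<^esub> w i \<in> S"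
    using S unfolding coproduct_cover_def by blast
  from cover_separated[OF this(1-3) y] eq[OF mem] show ?thesis by blast
qed

text \<open>Whether a section \<open>z\<close> over a coproduct has the same restriction along \<open>u\<close> and \<open>v\<close> can be
  tested on pieces that each of \<open>u\<close> and \<open>v\<close> sends into a single summand: split \<open>Z\<close> along \<open>u\<close>,
  then each piece along \<open>v\<close>, and use that sections over finite coproducts are determined by the
  summands.\<close>

lemma coproduct_maps_agree:
  assumes I: "finite (I :: nat set)" and Q: "is_coproduct C I T Q \<iota>" and z: "z \<in> PObj F Q"
    and u: "u \<in> Hom C Z Q" and v: "v \<in> Hom C Z Q"
    and compat: "\<And>i j V a b. i \<in> I \<Longrightarrow> j \<in> I \<Longrightarrow> a \<in> Hom C V (T i) \<Longrightarrow> b \<in> Hom C V (T j) \<Longrightarrow>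
      (\<exists>s\<in>Hom C V Z. u \<cdot>\<^bsub>C\<^esub> s = \<iota> i \<cdot>\<^bsub>C\<^esub> a \<and> v \<cdot>\<^bsub>C\<^esub> s = \<iota> j \<cdot>\<^bsub>C\<^esub> b) \<Longrightarrow>
      PMap F a (PMap F (\<iota> i) z) = PMap F b (PMap F (\<iota> j) z)"
  shows "PMap F u z = PMap F v z"
proof -
  note F = presheaf
  obtain V s a where V: "is_coproduct C I V Z s"
    and a: "\<And>i. i \<in> I \<Longrightarrow> a i \<in> Hom C (V i) (T i)" "\<And>i. i \<in> I \<Longrightarrow> \<iota> i \<cdot>\<^bsub>C\<^esub> a i = u \<cdot>\<^bsub>C\<^esub> s i"
    using coproduct_pullback[OF extensive I Q u] by blast
  show ?thesis
  proof (rule coproduct_separated[OF I V PMap_PObj[OF F u z] PMap_PObj[OF F v z]])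
    fix i assume i: "i \<in> I"
    note s = coproduct_Hom[OF V i]
    note us = Comp_Hom[OF s u] and vs = Comp_Hom[OF s v]
    obtain V' s' b where V': "is_coproduct C I V' (V i) s'"
      and b: "\<And>j. j \<in> I \<Longrightarrow> b j \<in> Hom C (V' j) (T j)"
        "\<And>j. j \<in> I \<Longrightarrow> \<iota> j \<cdot>\<^bsub>C\<^esub> b j = (v \<cdot>\<^bsub>C\<^esub> s i) \<cdot>\<^bsub>C\<^esub> s' j"
      using coproduct_pullback[OF extensive I Q vs] by blast
    have "PMap F (u \<cdot>\<^bsub>C\<^esub> s i) z = PMap F (v \<cdot>\<^bsub>C\<^esub> s i) z"
    proof (rule coproduct_separated[OF I V' PMap_PObj[OF F us z] PMap_PObj[OF F vs z]])
      fix j assume j: "j \<in> I"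
      note s' = coproduct_Hom[OF V' j] and ai = a(1)[OF i] and bj = b(1)[OF j]
      note \<iota>i = coproduct_Hom[OF Q i] and \<iota>j = coproduct_Hom[OF Q j]
      have ua: "(u \<cdot>\<^bsub>C\<^esub> s i) \<cdot>\<^bsub>C\<^esub> s' j = \<iota> i \<cdot>\<^bsub>C\<^esub> (a i \<cdot>\<^bsub>C\<^esub> s' j)"
        using a(2)[OF i] Comp_assoc[OF s' ai \<iota>i] by simp
      have "PMap F (a i \<cdot>\<^bsub>C\<^esub> s' j) (PMap F (\<iota> i) z) = PMap F (b j) (PMap F (\<iota> j) z)"
      proof (rule compat[OF i j Comp_Hom[OF s' ai] bj], intro bexI conjI)
        show "s i \<cdot>\<^bsub>C\<^esub> s' j \<in> Hom C (V' j) Z" using Comp_Hom[OF s' s] .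
        show "u \<cdot>\<^bsub>C\<^esub> (s i \<cdot>\<^bsub>C\<^esub> s' j) = \<iota> i \<cdot>\<^bsub>C\<^esub> (a i \<cdot>\<^bsub>C\<^esub> s' j)"
          using ua Comp_assoc[OF s' s u] by simp
        show "v \<cdot>\<^bsub>C\<^esub> (s i \<cdot>\<^bsub>C\<^esub> s' j) = \<iota> j \<cdot>\<^bsub>C\<^esub> b j"
          using b(2)[OF j] Comp_assoc[OF s' s v] by simp
      qed
      then show "PMap F (s' j) (PMap F (u \<cdot>\<^bsub>C\<^esub> s i) z) = PMap F (s' j) (PMap F (v \<cdot>\<^bsub>C\<^esub> s i) z)"
        using PMap_Comp[OF F s' us z] PMap_Comp[OF F s' vs z] ua b(2)[OF j]
          PMap_Comp[OF F Comp_Hom[OF s' ai] \<iota>i z] PMap_Comp[OF F bj \<iota>j z] by simp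
    qed
    then show "PMap F (s i) (PMap F u z) = PMap F (s i) (PMap F v z)"
      using PMap_Comp[OF F s u z] PMap_Comp[OF F s v z] by simp
  qed
qed

text \<open>The sections \<open>x (\<pi> \<iota>\<^sub>i)\<close> glue to \<open>z\<close> over \<open>Q\<close>. On a piece where two maps equalized by \<open>\<pi>\<close> factor
  through summands, both restrictions of \<open>z\<close> are the value of \<open>x\<close> at one and the same member of
  the sieve, so \<open>z\<close> descends to \<open>y\<close> over \<open>B\<close>. That \<open>y\<close> restricts correctly along an arbitrary
  \<open>f \<in> S\<close>, not only along the \<open>\<pi> \<iota>\<^sub>i\<close>, is checked on a cover of the domain of \<open>f\<close> lifting to \<open>Q\<close>.\<close>

lemma sheaf_for_coproduct_cover:
  assumes S: "is_sieve C B S" "coproduct_cover C B S"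
  shows "sheaf_for C F B S"
proof (rule sheaf_forI)
  show "y = z" if "y \<in> PObj F B" "z \<in> PObj F B" "\<And>f. f \<in> S \<Longrightarrow> PMap F f y = PMap F f z" for y z
    using coproduct_cover_separated[OF S(2) that] .
  fix x assume x: "matching_family C F S x"
  note F = presheaf
  obtain Q \<pi> T \<iota> and I :: "nat set" where epi: "effective_epi C Q B \<pi>" and I: "finite I"
    and Q: "is_coproduct C I T Q \<iota>" and mem: "\<And>i. i \<in> I \<Longrightarrow> \<pi> \<cdot>\<^bsub>C\<^esub> \<iota> i \<in> S"
    using S(2) unfolding coproduct_cover_def by blast
  have \<pi>: "\<pi> \<in> Hom C Q B" using effective_epi_Hom[OF epi] .
  note \<iota> = coproduct_Hom[OF Q]
  note \<pi>\<iota> = Comp_Hom[OF \<iota> \<pi>]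
  have "x (\<pi> \<cdot>\<^bsub>C\<^esub> \<iota> i) \<in> PObj F (T i)" if "i \<in> I" for i
    using matching_PObj[OF x mem \<pi>\<iota>] that by blast
  then obtain z where z: "z \<in> PObj F Q" "\<And>i. i \<in> I \<Longrightarrow> PMap F (\<iota> i) z = x (\<pi> \<cdot>\<^bsub>C\<^esub> \<iota> i)"
    using coproduct_glue[OF I Q, of "\<lambda>i. x (\<pi> \<cdot>\<^bsub>C\<^esub> \<iota> i)"] by blast
  have restr: "PMap F a (PMap F (\<iota> i) z) = x (\<pi> \<cdot>\<^bsub>C\<^esub> (\<iota> i \<cdot>\<^bsub>C\<^esub> a))"
    if i: "i \<in> I" and a: "a \<in> Hom C V (T i)" for i V a
    using z(2)[OF i] matching_PMap[OF x mem[OF i] \<pi>\<iota>[OF i] a] Comp_assoc[OF a \<iota>[OF i] \<pi>] by simp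
  obtain y where y: "y \<in> PObj F B" "PMap F \<pi> y = z"
  proof (rule effective_epi_descent[OF epi z(1)])
    fix Z u v assume u: "u \<in> Hom C Z Q" and v: "v \<in> Hom C Z Q" and eq: "\<pi> \<cdot>\<^bsub>C\<^esub> u = \<pi> \<cdot>\<^bsub>C\<^esub> v"
    show "PMap F u z = PMap F v z"
    proof (rule coproduct_maps_agree[OF I Q z(1) u v])
      fix i j V a b assume i: "i \<in> I" and j: "j \<in> I" and a: "a \<in> Hom C V (T i)"
        and b: "b \<in> Hom C V (T j)"
        and "\<exists>s\<in>Hom C V Z. u \<cdot>\<^bsub>C\<^esub> s = \<iota> i \<cdot>\<^bsub>C\<^esub> a \<and> v \<cdot>\<^bsub>C\<^esub> s = \<iota> j \<cdot>\<^bsub>C\<^esub> b"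
      then obtain s where s: "s \<in> Hom C V Z" "u \<cdot>\<^bsub>C\<^esub> s = \<iota> i \<cdot>\<^bsub>C\<^esub> a"
        "v \<cdot>\<^bsub>C\<^esub> s = \<iota> j \<cdot>\<^bsub>C\<^esub> b" by blast
      have "\<pi> \<cdot>\<^bsub>C\<^esub> (\<iota> i \<cdot>\<^bsub>C\<^esub> a) = \<pi> \<cdot>\<^bsub>C\<^esub> (\<iota> j \<cdot>\<^bsub>C\<^esub> b)"
        using Comp_assoc[OF s(1) u \<pi>] Comp_assoc[OF s(1) v \<pi>] eq s(2,3) by simp
      then show "PMap F a (PMap F (\<iota> i) z) = PMap F b (PMap F (\<iota> j) z)"
        using restr[OF i a] restr[OF j b] by simp
    qed
  qed
  have "PMap F f y = x f" if f: "f \<in> S" for f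
  proof -
    note fH = sieve_Hom[OF S(1) f]
    obtain W \<rho> U w t where \<rho>: "effective_epi C W (Dom C f) \<rho>" and w: "is_coproduct C I U W w"
      and t: "\<And>i. i \<in> I \<Longrightarrow> t i \<in> Hom C (U i) (T i)"
        "\<And>i. i \<in> I \<Longrightarrow> f \<cdot>\<^bsub>C\<^esub> (\<rho> \<cdot>\<^bsub>C\<^esub> w i) = (\<pi> \<cdot>\<^bsub>C\<^esub> \<iota> i) \<cdot>\<^bsub>C\<^esub> t i"
      using cover_lift[OF epi I Q fH] by blast
    show ?thesis
    proof (rule cover_separated[OF \<rho> I w PMap_PObj[OF F fH y(1)] matching_PObj[OF x f fH]])
      fix i assume i: "i \<in> I"
      note \<rho>w = Comp_Hom[OF coproduct_Hom[OF w i] effective_epi_Hom[OF \<rho>]]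
      have "PMap F (\<rho> \<cdot>\<^bsub>C\<^esub> w i) (PMap F f y) = PMap F (t i) (PMap F (\<pi> \<cdot>\<^bsub>C\<^esub> \<iota> i) y)"
        using PMap_Comp[OF F \<rho>w fH y(1)] PMap_Comp[OF F t(1)[OF i] \<pi>\<iota>[OF i] y(1)] t(2)[OF i] by simp
      also have "\<dots> = PMap F (t i) (x (\<pi> \<cdot>\<^bsub>C\<^esub> \<iota> i))"
        using PMap_Comp[OF F \<iota>[OF i] \<pi> y(1)] y(2) z(2)[OF i] by simp
      also have "\<dots> = x (f \<cdot>\<^bsub>C\<^esub> (\<rho> \<cdot>\<^bsub>C\<^esub> w i))"
        using matching_PMap[OF x mem[OF i] \<pi>\<iota>[OF i] t(1)[OF i]] t(2)[OF i] by simp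
      also have "\<dots> = PMap F (\<rho> \<cdot>\<^bsub>C\<^esub> w i) (x f)" using matching_PMap[OF x f fH \<rho>w] by simp
      finally show "PMap F (\<rho> \<cdot>\<^bsub>C\<^esub> w i) (PMap F f y) = PMap F (\<rho> \<cdot>\<^bsub>C\<^esub> w i) (x f)" .
    qed
  qed
  then show "\<exists>y\<in>PObj F B. \<forall>f\<in>S. PMap F f y = x f" using y(1) by blast
qed

lemma generated_sieve_coproduct_cover:
  assumes I: "finite (I :: nat set)" and f: "effective_epi_family C I X B f"
  shows "coproduct_cover C B (generated_sieve C I f)"
proof -
  have fH: "f i \<in> Hom C (X i) B" if "i \<in> I" for i
    using f that unfolding effective_epi_family_def by blast
  have B: "B \<in> Obj C" using f unfolding effective_epi_family_def by blast
  obtain Q \<iota> where Q: "is_coproduct C I X Q \<iota>"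
    using finite_coproduct_exists[OF extensive I, of X] Hom_Obj(1)[OF fH] by blast
  obtain \<pi> where \<pi>: "\<pi> \<in> Hom C Q B" "\<And>i. i \<in> I \<Longrightarrow> \<pi> \<cdot>\<^bsub>C\<^esub> \<iota> i = f i"
    using coproduct_factor[OF Q B, of f] fH by blast
  have "f i \<in> generated_sieve C I f" if i: "i \<in> I" for i
  proof -
    have "Id C (X i) \<in> Arr C \<and> Cod C (Id C (X i)) = Dom C (f i)"
      using Id_Hom[OF Hom_Obj(1)[OF fH[OF i]]] fH[OF i] by (simp add: Hom_def)
    then show ?thesis using Comp_Id[OF fH[OF i]] i unfolding generated_sieve_def by force
  qed
  then show ?thesis
    using effective_epi_of_family[OF f Q \<pi>] I Q \<pi>(2) unfolding coproduct_cover_def by metis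
qed

lemma coherent_sheaf: "is_sheaf C (coherent_topology C) F"
proof -
  have "covers_finite_effective_epi_families C (finest_topology C F)"
    unfolding covers_finite_effective_epi_families_def
  proof (intro allI impI)
    fix I :: "nat set" and X B f assume "finite I \<and> effective_epi_family C I X B f"
    then have I: "finite I" and f: "effective_epi_family C I X B f" by auto
    note S = is_sieve_generated[OF f]
    show "generated_sieve C I f \<in> finest_topology C F B"
      unfolding finest_topology_def
      using S sheaf_for_coproduct_cover[OF is_sieve_pullback[OF S]
        coproduct_cover_pullback[OF S generated_sieve_coproduct_cover[OF I f]]] by blast
  qed
  then have "coherent_topology C B \<subseteq> finest_topology C F B" for B
    by (rule coherent_topology_least[OF grothendieck_topology_finest[OF presheaf]])
  then show ?thesis
    unfolding is_sheaf_def sheaf_for_def[symmetric] using finest_topology_sheaf_for by blast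
qed

end

theorem proposition6p13:
  fixes C :: "('o, 'a) cat" and F :: "('o, 'a, 'v) psh"
  assumes "category C"
    and "preregular C"
    and "finitary_extensive C"
    and "\<And>X B \<pi>. effective_epi C X B \<pi> \<Longrightarrow> \<exists>p q. is_pullback C p q \<pi> \<pi>"
    and "presheaf C F"
  shows "is_sheaf C (coherent_topology C) F \<longleftrightarrow>
    (\<forall>X B \<pi> p q. effective_epi C X B \<pi> \<and> is_pullback C p q \<pi> \<pi> \<longrightarrow>
      set_equalizer (PObj F B) (PMap F \<pi>) (PObj F X) (PMap F p) (PMap F q)) \<and>
    preserves_finite_products C F"
proof
  assume "is_sheaf C (coherent_topology C) F"
  then show "(\<forall>X B \<pi> p q. effective_epi C X B \<pi> \<and> is_pullback C p q \<pi> \<pi> \<longrightarrow>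
      set_equalizer (PObj F B) (PMap F \<pi>) (PObj F X) (PMap F p) (PMap F q)) \<and>
    preserves_finite_products C F"
    using category.coherent_sheaf_equalizer[OF assms(1,5)]
      category.coherent_sheaf_preserves_finite_products[OF assms(1,5) _ assms(3)] by blast
next
  assume "(\<forall>X B \<pi> p q. effective_epi C X B \<pi> \<and> is_pullback C p q \<pi> \<pi> \<longrightarrow>
      set_equalizer (PObj F B) (PMap F \<pi>) (PObj F X) (PMap F p) (PMap F q)) \<and>
    preserves_finite_products C F"
  then have "descent_presheaf C F"
    using assms unfolding descent_presheaf_def descent_presheaf_axioms_def by blast
  then show "is_sheaf C (coherent_topology C) F" by (rule descent_presheaf.coherent_sheaf)
qed

end
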